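(* Consider the two-player zero-sum sequential game described in the context. Suppose that the following two assumptions hold. (i) There exists $m\in\mathbb{N}$ such that $$\rho:=\sup_{\pi_R\in\overline\Pi_R,\ \pi_P\in\overline\Pi_P,\ s\in\mathcal S}\mathbb{P}^{\pi_R,\pi_P}[S_m\neq\Delta\mid S_0=s]<1 .$$ (ii) For every $s\in\mathcal S$ and all sequences $a_R^k\in A_R(s)$, $a_P^k\in A_P(s,a_R^k)$ with $\lim_{k\to\infty} a_R^k=a_R\in A_R(s)$ and $\lim_{k\to\infty}a_P^k=a_P\in A_P(s,a_R)$, one has $\lim_{k\to\infty}p(s'|s,a_R^k,a_P^k)=p(s'|s,a_R,a_P)$ for all $s'\in\mathcal S$. Starting from any $\pi_R^0\in\Pi_R$, define for all $k\ge 0$ $$V^{\pi_R^k}(s):=\min_{\pi_P\in\Pi_P}V^{\pi_R^k,\pi_P}(s)\qquad\forall s\in\mathcal S,$$ $$\pi_R^{k+1}(s)\in\operatorname*{arg\,max}_{a_R\in A_R(s)}\Big\{\min_{a_P\in A_P(s,a_R)}\sum_{s'\in\mathcal S}[r(s'|s)+V^{\pi_R^k}(s')]\,p(s'|s,a_R,a_P)\Big\}\qquad\forall s\in\mathcal S.$$ Then $V^{\pi_R^k}\uparrow V^*$, i.e. for every $s\in\mathcal S$ the sequence $(V^{\pi_R^k}(s))_{k\ge0}$ is nondecreasing and converges to $V^*(s)$.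
   Context: **States.** $\mathcal X$ is the set of $s=(b,c,d,o)$ with $b\in\{0,1\}^3$, $c\in\{0,1,2,3\}\times\{0,1,2\}$, $d\in\{0,1,2\}$, $o\in\{0,1,2\}$. $\widetilde{\mathcal X}=\{0,1,2,3\}$ is a set of four "penultimate" states (disjoint from $\mathcal X$), and $\Delta$ is a terminal state. The state space is the finite set $\mathcal S=\mathcal X\cup\widetilde{\mathcal X}\cup\{\Delta\}$. **Actions.** There are a runner (maximizer) and a pitcher (minimizer); $\delta$ is a dummy action. The runner's action set is $A_R(s)=[0,20]$ if $s=(b,c,d,o)\in\mathcal X$ with $b=(1,0,0)$, and $A_R(s)=\{\delta\}$ for all other $s\in\mathcal S$. For $a_R\in A_R(s)$, the pitcher's action set is $A_P(s,a_R)=\{0,1\}$ if $s=(b,c,d,o)\in\mathcal X$ with $b=(1,0,0)$, and $A_P(s,a_R)=\{\delta\}$ for all other $s\in\mathcal S$. **Transitions.** For all $s\in\mathcal S$, $a_R\in A_R(s)$, $a_P\in A_P(s,a_R)$, $p(\cdot\mid s,a_R,a_P)$ is a probability distribution on $\mathcal S$. Every state of $\widetilde{\mathcal X}$ moves to $\Delta$ with probability 1, and $\Delta$ is absorbing. At each stage the runner chooses $a_R\in A_R(s)$ after observing $s$; the pitcher chooses $a_P\in A_P(s,a_R)$ after observing $(s,a_R)$; the next state is drawn from $p(\cdot\mid s,a_R,a_P)$. **Rewards.** With $g:\{0,1\}^3\to\{0,1,2,3\}$ the number of ones in $b$, the reward for a transition from $s$ to $s'$ is $r(s'|s)=(g(b)+o)-(g(b')+o')+\mathbb{I}\{c'=(0,0),\,d'=0\}$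 if $s=(b,c,d,o),\,s'=(b',c',d',o')\in\mathcal X$; $r(s'|s)=s'$ if $s\in\mathcal X$, $s'\in\widetilde{\mathcal X}$; $r(s'|s)=0$ if $s'=\Delta$. The remaining pairs have transition probability zero; their reward is irrelevant and may be set to $0$. **Policies.** $\mathbb{F}_R$ is the set of functions $f$ on $\mathcal S$ with $f(s)\in A_R(s)$ for all $s$. $\mathbb{K}_P=\{(s,a_R): s\in\mathcal S,\ a_R\in A_R(s)\}$, and $\mathbb{F}_P$ is the set of functions $f$ on $\mathbb{K}_P$ with $f(s,a_R)\in A_P(s,a_R)$ for all $(s,a_R)\in\mathbb K_P$. A deterministic Markovian policy for the runner (resp. pitcher) is a sequence $(\pi_0,\pi_1,\ldots)$ in $\mathbb{F}_R$ (resp. $\mathbb{F}_P$); the set of these is $\overline\Pi_R$ (resp. $\overline\Pi_P$). It is stationary if all $\pi_t$ equal one decision rule; $\Pi_R\subseteq\overline\Pi_R$ and $\Pi_P\subseteq\overline\Pi_P$ denote the sets of stationary policies, and a stationary policy is identified with its decision rule. **Values.** $S_t$ is the state at stage $t$; $\mathbb{P}^{\pi_R,\pi_P}$ and $\mathbb{E}^{\pi_R,\pi_P}$ are the probability and expectation induced by the policies. Define $$V^{\pi_R,\pi_P}(s)=\mathbb{E}^{\pi_R,\pi_P}\Big[\sum_{t=0}^\infty r(S_{t+1}|S_t)\,\Big|\,S_0=s\Big],\qquad V^*(s)=\max_{\pi_R\in\overline\Pi_R}\min_{\pi_P\in\overline\Pi_P}V^{\pi_R,\pi_P}(s),\quad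 s\in\mathcal S.$$ (In the definition of $V^*$, max and min are read as supremum and infimum, so that no attainment is presupposed.) *)

theory Defs
  imports "HOL-Probability.Probability"
begin

datatype state =
    Live "nat \<times> nat \<times> nat" "nat \<times> nat" nat nat
  | Penult nat
  | Terminal

definition live_states :: "state set" where
  "live_states = {Live b c d u | b c d u.
     b \<in> {0..1} \<times> {0..1} \<times> {0..1} \<and> c \<in> {0..3} \<times> {0..2} \<and> d \<in> {0..2} \<and> u \<in> {0..2}}"

definition penult_states :: "state set" where
  "penult_states = Penult ` {0..3}"

definition states :: "state set" where
  "states = live_states \<union> penult_states \<union> {Terminal}"

(* Both players' actions are real numbers. The dummy action is a real number outside [0,20] and
   {0,1}, hence isolated in every action set, and convergence of actions is convergence in the
   reals. *)
definition dummy :: real where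
  "dummy = -1"

fun runner_acts :: "state \<Rightarrow> real set" where
  "runner_acts (Live b c d u) = (if b = (1, 0, 0) then {0..20} else {dummy})"
| "runner_acts _ = {dummy}"

fun pitcher_acts :: "state \<Rightarrow> real \<Rightarrow> real set" where
  "pitcher_acts (Live b c d u) a = (if b = (1, 0, 0) then {0, 1} else {dummy})"
| "pitcher_acts _ a = {dummy}"

definition transition_law :: "(state \<Rightarrow> real \<Rightarrow> real \<Rightarrow> state pmf) \<Rightarrow> bool" where
  "transition_law p \<longleftrightarrow>
     (\<forall>s\<in>states. \<forall>a\<in>runner_acts s. \<forall>a'\<in>pitcher_acts s a.
        set_pmf (p s a a') \<subseteq> states \<and>
        (s \<in> penult_states \<union> {Terminal} \<longrightarrow> p s a a' = return_pmf Terminal))"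

fun ones :: "nat \<times> nat \<times> nat \<Rightarrow> nat" where
  "ones (b1, b2, b3) = b1 + b2 + b3"

(* reward s s' is r(s'|s). *)
fun reward :: "state \<Rightarrow> state \<Rightarrow> real" where
  "reward (Live b c d u) (Live b' c' d' u') =
     (real (ones b) + real u) - (real (ones b') + real u') + of_bool (c' = (0, 0) \<and> d' = 0)"
| "reward (Live b c d u) (Penult i) = real i"
| "reward _ _ = 0"

(* Decision rules are total HOL functions; their values outside states and Sigma states runner_acts
   are unconstrained and do not affect the values of the game, since play started in states stays
   there. *)
definition runner_rules :: "(state \<Rightarrow> real) set" where
  "runner_rules = Pi states runner_acts"

definition pitcher_rules :: "(state \<times> real \<Rightarrow> real) set" where
  "pitcher_rules = Pi (Sigma states runner_acts) (\<lambda>(s, a). pitcher_acts s a)"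

definition runner_markov :: "(nat \<Rightarrow> state \<Rightarrow> real) set" where
  "runner_markov = {\<pi>. \<forall>t. \<pi> t \<in> runner_rules}"

definition pitcher_markov :: "(nat \<Rightarrow> state \<times> real \<Rightarrow> real) set" where
  "pitcher_markov = {\<pi>. \<forall>t. \<pi> t \<in> pitcher_rules}"

definition pitcher_stationary :: "(nat \<Rightarrow> state \<times> real \<Rightarrow> real) set" where
  "pitcher_stationary = {\<lambda>t. g | g. g \<in> pitcher_rules}"

(* Conditional law of the state at stage n given the earlier states, for a game started in s. *)
fun stage_law :: "(state \<Rightarrow> real \<Rightarrow> real \<Rightarrow> state pmf) \<Rightarrow> (nat \<Rightarrow> state \<Rightarrow> real) \<Rightarrow>
    (nat \<Rightarrow> state \<times> real \<Rightarrow> real) \<Rightarrow> state \<Rightarrow> nat \<Rightarrow> (nat \<Rightarrow> state) \<Rightarrow> state measure" where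
  "stage_law p \<pi>R \<pi>P s 0 \<omega> = measure_pmf (return_pmf s)"
| "stage_law p \<pi>R \<pi>P s (Suc t) \<omega> =
     measure_pmf (p (\<omega> t) (\<pi>R t (\<omega> t)) (\<pi>P t (\<omega> t, \<pi>R t (\<omega> t))))"

lemma Ionescu_Tulcea_stage_law:
  "Ionescu_Tulcea (stage_law p \<pi>R \<pi>P s) (\<lambda>_. count_space UNIV)"
proof (rule Ionescu_Tulcea.intro)
  fix i
  show "stage_law p \<pi>R \<pi>P s i \<in>
      measurable (PiM {0..<i} (\<lambda>_. count_space UNIV)) (subprob_algebra (count_space UNIV))"
  proof (cases i)
    case 0
    have "stage_law p \<pi>R \<pi>P s 0 = (\<lambda>\<omega>. measure_pmf (return_pmf s))"
      by (rule ext) simp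
    then show ?thesis
      by (simp add: 0 measure_pmf_in_subprob_algebra)
  next
    case (Suc t)
    let ?q = "\<lambda>x. measure_pmf (p x (\<pi>R t x) (\<pi>P t (x, \<pi>R t x)))"
    have "(\<lambda>\<omega>. ?q (\<omega> t)) \<in>
        measurable (PiM {0..<i} (\<lambda>_. count_space UNIV)) (subprob_algebra (count_space UNIV))"
      by (rule measurable_compose[where g = ?q and N = "count_space UNIV"],
          rule measurable_component_singleton)
        (auto simp: Suc measure_pmf_in_subprob_algebra)
    moreover have "stage_law p \<pi>R \<pi>P s i = (\<lambda>\<omega>. ?q (\<omega> t))"
      by (rule ext) (simp add: Suc)
    ultimately show ?thesis
      by simp
  qed
next
  fix i \<omega>
  show "prob_space (stage_law p \<pi>R \<pi>P s i \<omega>)"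
    by (cases i) (simp_all add: measure_pmf.prob_space_axioms)
qed

(* The law of the state process (S_t) started in s: the measure that the Ionescu-Tulcea theorem
   gives on the product space of all state sequences. *)
definition path_measure :: "(state \<Rightarrow> real \<Rightarrow> real \<Rightarrow> state pmf) \<Rightarrow> (nat \<Rightarrow> state \<Rightarrow> real) \<Rightarrow>
    (nat \<Rightarrow> state \<times> real \<Rightarrow> real) \<Rightarrow> state \<Rightarrow> (nat \<Rightarrow> state) measure" where
  "path_measure p \<pi>R \<pi>P s =
     projective_family.lim UNIV
       (Ionescu_Tulcea.CI (stage_law p \<pi>R \<pi>P s) (\<lambda>_. count_space UNIV)) (\<lambda>_. count_space UNIV)"

definition val :: "(state \<Rightarrow> real \<Rightarrow> real \<Rightarrow> state pmf) \<Rightarrow> (nat \<Rightarrow> state \<Rightarrow> real) \<Rightarrow>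
    (nat \<Rightarrow> state \<times> real \<Rightarrow> real) \<Rightarrow> state \<Rightarrow> real" where
  "val p \<pi>R \<pi>P s = (LINT \<omega>|path_measure p \<pi>R \<pi>P s. (\<Sum>t. reward (\<omega> t) (\<omega> (Suc t))))"

definition opt_val :: "(state \<Rightarrow> real \<Rightarrow> real \<Rightarrow> state pmf) \<Rightarrow> state \<Rightarrow> real" where
  "opt_val p s = (SUP \<pi>R\<in>runner_markov. INF \<pi>P\<in>pitcher_markov. val p \<pi>R \<pi>P s)"

(* The value of the stationary runner policy with decision rule f against stationary pitchers. *)
definition rule_val :: "(state \<Rightarrow> real \<Rightarrow> real \<Rightarrow> state pmf) \<Rightarrow> (state \<Rightarrow> real) \<Rightarrow> state \<Rightarrow> real" where
  "rule_val p f s = (INF \<pi>P\<in>pitcher_stationary. val p (\<lambda>t. f) \<pi>P s)"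

definition one_step :: "(state \<Rightarrow> real \<Rightarrow> real \<Rightarrow> state pmf) \<Rightarrow> (state \<Rightarrow> real) \<Rightarrow>
    state \<Rightarrow> real \<Rightarrow> real" where
  "one_step p v s a =
     (MIN a'\<in>pitcher_acts s a. \<Sum>s'\<in>states. (reward s s' + v s') * pmf (p s a a') s')"

end

theory Submission
  imports Defs
begin

text \<open>
  By compactness and continuity, the largest probability of surviving \<open>k\<close> stages is attained by
  Markov policies, so the absorption assumption yields a weight \<open>h\<close>, at least \<open>1\<close> off \<open>Terminal\<close>
  and \<open>0\<close> at \<open>Terminal\<close>, whose expectation shrinks by a factor \<open>\<beta> < 1\<close> in every stage under
  all actions. All Bellman operators are then \<open>\<beta>\<close>-contractions for the norm weighted by \<open>h\<close>, and a
  function vanishing at \<open>Terminal\<close> that is below (above) its own lookahead along a pair of Markov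
  policies is below (above) their value. Hence \<open>opt_val\<close> and every \<open>rule_val\<close> are the fixed points
  of their Bellman operators. An improvement step gives \<open>V k \<le> T (V k) \<le> V (Suc k) \<le> opt_val\<close>,
  which is monotone and converges geometrically.
\<close>

section \<open>Laws of the state process\<close>

text \<open>Countability makes maps into pairs of states measurable for the discrete sigma-algebra
  on pairs, so consecutive states can be treated jointly.\<close>

instance state :: countable
  by countable_datatype

text \<open>\<open>stage_law\<close> at \<open>Suc t\<close> sees the history only through
  \<open>\<omega> t\<close>. This is that dependence: play is an inhomogeneous Markov chain with
  these kernels.\<close>

definition kernel :: "(state \<Rightarrow> real \<Rightarrow> real \<Rightarrow> state pmf) \<Rightarrow> (nat \<Rightarrow> state \<Rightarrow> real) \<Rightarrow>
    (nat \<Rightarrow> state \<times> real \<Rightarrow> real) \<Rightarrow> nat \<Rightarrow> state \<Rightarrow> state pmf" where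
  "kernel p \<pi>R \<pi>P t x = p x (\<pi>R t x) (\<pi>P t (x, \<pi>R t x))"

primrec marg :: "(nat \<Rightarrow> 'a \<Rightarrow> 'a pmf) \<Rightarrow> 'a \<Rightarrow> nat \<Rightarrow> 'a pmf" where
  "marg K s 0 = return_pmf s"
| "marg K s (Suc n) = bind_pmf (marg K s n) (K n)"

text \<open>Splitting off the first step instead of the last allows a decision to be put in front of
  given Markov policies.\<close>

lemma marg_shift: "marg K s (Suc n) = bind_pmf (K 0 s) (\<lambda>x. marg (\<lambda>t. K (Suc t)) x n)"
proof (induction n)
  case 0
  then show ?case by (simp add: bind_return_pmf bind_return_pmf')
next
  case (Suc n)
  have "marg K s (Suc (Suc n)) = bind_pmf (marg K s (Suc n)) (K (Suc n))"
    by simp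
  also have "\<dots> = bind_pmf (K 0 s) (\<lambda>x. bind_pmf (marg (\<lambda>t. K (Suc t)) x n) (K (Suc n)))"
    by (subst Suc.IH) (rule bind_assoc_pmf)
  finally show ?case
    by simp
qed

section \<open>Integrals against the Ionescu-Tulcea limit\<close>

lemma (in Ionescu_Tulcea) CI_Ico: "CI {0..<n} = C 0 n (\<lambda>_. undefined)"
proof -
  \<comment> \<open>\<open>CI J\<close> is the law of the first \<open>up_to J\<close> coordinates
    cut down to \<open>J\<close>; for an initial segment nothing is cut off.\<close>
  have "up_to {0..<n} = n"
    using up_to_iff_Ico[of "{0..<n}"] up_to[of "{0..<n}"]
    by (metis dual_order.antisym finite_atLeastLessThan ivl_subset less_eq_nat.simps(1) order_refl
        not_less_zero atLeastLessThan_empty_iff bot_nat_0.extremum_uniqueI)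
  then show ?thesis
    using distr_C[of n n "\<lambda>_. undefined" 0] by (simp add: CI_def space_PiM)
qed

lemma (in Ionescu_Tulcea) nn_integral_lim:
  assumes "f \<in> borel_measurable (PiM {0..<n} M)"
  shows "(\<integral>\<^sup>+\<omega>. f (restrict \<omega> {0..<n}) \<partial>PF.lim) = (\<integral>\<^sup>+\<omega>. f \<omega> \<partial>C 0 n (\<lambda>_. undefined))"
proof -
  have "(\<integral>\<^sup>+\<omega>. f \<omega> \<partial>C 0 n (\<lambda>_. undefined)) =
      (\<integral>\<^sup>+\<omega>. f \<omega> \<partial>distr PF.lim (PiM {0..<n} M) (\<lambda>x. restrict x {0..<n}))"
    by (simp add: distr_lim CI_Ico)
  also have "\<dots> = (\<integral>\<^sup>+\<omega>. f (restrict \<omega> {0..<n}) \<partial>PF.lim)"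
    using assms by (intro nn_integral_distr) (auto simp: measurable_cong_sets[OF PF.sets_lim refl]
        intro!: measurable_restrict_subset)
  finally show ?thesis ..
qed

text \<open>\<open>C 0 (Suc n)\<close> is \<open>C 0 n\<close> followed by one draw from
  \<open>eP n\<close>, so the newest coordinate can be integrated out first. With the limit measure
  on both sides the identity can be iterated.\<close>

lemma (in Ionescu_Tulcea) nn_integral_lim_Suc:
  assumes [measurable]: "f \<in> borel_measurable (PiM {0..<Suc n} M)"
  shows "(\<integral>\<^sup>+\<omega>. f (restrict \<omega> {0..<Suc n}) \<partial>PF.lim) =
    (\<integral>\<^sup>+\<omega>. (\<integral>\<^sup>+x. f (fun_upd (restrict \<omega> {0..<n}) n x) \<partial>P n (restrict \<omega> {0..<n})) \<partial>PF.lim)"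
proof -
  let ?g = "\<lambda>\<omega>. \<integral>\<^sup>+x. f x \<partial>eP n \<omega>"
  have g: "?g \<in> borel_measurable (PiM {0..<n} M)"
    by measurable
  have "(\<integral>\<^sup>+\<omega>. f (restrict \<omega> {0..<Suc n}) \<partial>PF.lim) = (\<integral>\<^sup>+\<omega>. ?g \<omega> \<partial>C 0 n (\<lambda>_. undefined))"
    by (simp only: nn_integral_lim[OF assms] C.simps add_0)
      (rule nn_integral_bind[where B = "PiM {0..<Suc n} M"], auto simp: space_PiM
        measurable_cong_sets[OF sets_C refl])
  also have "\<dots> = (\<integral>\<^sup>+\<omega>. ?g (restrict \<omega> {0..<n}) \<partial>PF.lim)"
    by (rule nn_integral_lim[OF g, symmetric])
  also have "\<dots> = (\<integral>\<^sup>+\<omega>. (\<integral>\<^sup>+x. f (fun_upd (restrict \<omega> {0..<n}) n x) \<partial>P n (restrict \<omega> {0..<n})) \<partial>PF.lim)"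
    by (rule nn_integral_cong, rule nn_integral_eP) (auto simp: space_PiM)
  finally show ?thesis .
qed

section \<open>Laws of single and of consecutive states on the path space\<close>

context
  fixes p :: "state \<Rightarrow> real \<Rightarrow> real \<Rightarrow> state pmf" and \<pi>R :: "nat \<Rightarrow> state \<Rightarrow> real"
    and \<pi>P :: "nat \<Rightarrow> state \<times> real \<Rightarrow> real" and s :: state
begin

interpretation IT: Ionescu_Tulcea "stage_law p \<pi>R \<pi>P s" "\<lambda>_. count_space UNIV"
  by (rule Ionescu_Tulcea_stage_law)

lemma path_measure_eq: "path_measure p \<pi>R \<pi>P s = IT.PF.lim"
  by (simp add: path_measure_def)

lemma sets_path_measure [measurable_cong]:
  "sets (path_measure p \<pi>R \<pi>P s) = sets (PiM UNIV (\<lambda>_. count_space UNIV))"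
  by (simp add: path_measure_eq)

lemma space_path_measure [simp]: "space (path_measure p \<pi>R \<pi>P s) = UNIV"
  by (simp add: path_measure_eq space_PiM)

text \<open>Projection preserves total mass, and the projection to the empty set of coordinates is
  known to be a probability measure.\<close>

lemma prob_space_path_measure: "prob_space (path_measure p \<pi>R \<pi>P s)"
proof -
  have "prob_space (distr IT.PF.lim (PiM {} (\<lambda>_. count_space UNIV)) (\<lambda>x. restrict x {}))"
    using IT.distr_lim[of "{}"] IT.PF.prob_space_P[of "{}"] by simp
  then show ?thesis
    unfolding path_measure_eq
    by (rule prob_space_distrD[rotated])
      (auto simp: measurable_cong_sets[OF IT.PF.sets_lim refl] intro!: measurable_restrict_subset)
qed

text \<open>Markov property: coordinate \<open>Suc t\<close> is drawn from the
  stage-\<open>t\<close> kernel at the present state.\<close>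

lemma nn_integral_path_Suc:
  fixes F :: "state \<times> state \<Rightarrow> ennreal"
  shows "(\<integral>\<^sup>+\<omega>. F (\<omega> t, \<omega> (Suc t)) \<partial>path_measure p \<pi>R \<pi>P s) =
    (\<integral>\<^sup>+\<omega>. (\<integral>\<^sup>+y. F (\<omega> t, y) \<partial>kernel p \<pi>R \<pi>P t (\<omega> t)) \<partial>path_measure p \<pi>R \<pi>P s)"
proof -
  have "(\<lambda>\<omega>. F (\<omega> t, \<omega> (Suc t))) \<in> borel_measurable (PiM {0..<Suc (Suc t)} (\<lambda>_. count_space UNIV))"
    by measurable
  from IT.nn_integral_lim_Suc[OF this] show ?thesis
    by (simp add: path_measure_eq kernel_def)
qed

text \<open>Integrating out the last state replaces \<open>F\<close> by its kernel average, hence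
  the induction generalises over \<open>F\<close>.\<close>

lemma nn_integral_path:
  fixes F :: "state \<Rightarrow> ennreal"
  shows "(\<integral>\<^sup>+\<omega>. F (\<omega> t) \<partial>path_measure p \<pi>R \<pi>P s) = (\<integral>\<^sup>+x. F x \<partial>marg (kernel p \<pi>R \<pi>P) s t)"
proof (induction t arbitrary: F)
  case 0
  have "(\<lambda>\<omega>. F (\<omega> 0)) \<in> borel_measurable (PiM {0..<Suc 0} (\<lambda>_. count_space UNIV))"
    by measurable
  from IT.nn_integral_lim_Suc[OF this] show ?case
    using prob_space.emeasure_space_1[OF prob_space_path_measure]
    by (simp add: path_measure_eq nn_integral_return)
next
  case (Suc t)
  show ?case
    using nn_integral_path_Suc[of "\<lambda>(x, y). F y" t]
      Suc.IH[of "\<lambda>x. \<integral>\<^sup>+y. F y \<partial>kernel p \<pi>R \<pi>P t x"]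
    by simp
qed

lemma nn_integral_path_pair:
  fixes F :: "state \<times> state \<Rightarrow> ennreal"
  shows "(\<integral>\<^sup>+\<omega>. F (\<omega> t, \<omega> (Suc t)) \<partial>path_measure p \<pi>R \<pi>P s) =
    (\<integral>\<^sup>+x. (\<integral>\<^sup>+y. F (x, y) \<partial>kernel p \<pi>R \<pi>P t x) \<partial>marg (kernel p \<pi>R \<pi>P) s t)"
  unfolding nn_integral_path_Suc
  by (rule nn_integral_path[where F = "\<lambda>x. \<integral>\<^sup>+y. F (x, y) \<partial>kernel p \<pi>R \<pi>P t x"])

text \<open>A reward depends on two consecutive states, so values see only this joint law. Its pmf
  form gives integrability once the support is finite.\<close>

lemma distr_path_pair:
  "distr (path_measure p \<pi>R \<pi>P s) (count_space UNIV) (\<lambda>\<omega>. (\<omega> t, \<omega> (Suc t))) =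
    measure_pmf (bind_pmf (marg (kernel p \<pi>R \<pi>P) s t)
      (\<lambda>x. map_pmf (Pair x) (kernel p \<pi>R \<pi>P t x)))"
  (is "?D = measure_pmf ?M")
proof (rule measure_eqI)
  fix A assume "A \<in> sets ?D"
  have "emeasure ?D A = (\<integral>\<^sup>+z. indicator A z \<partial>?D)"
    by simp
  also have "\<dots> = (\<integral>\<^sup>+\<omega>. indicator A (\<omega> t, \<omega> (Suc t)) \<partial>path_measure p \<pi>R \<pi>P s)"
    by (rule nn_integral_distr) measurable
  also have "\<dots> = (\<integral>\<^sup>+z. indicator A z \<partial>?M)"
    by (simp only: nn_integral_path_pair nn_integral_bind_pmf nn_integral_map_pmf)
  also have "\<dots> = emeasure ?M A"
    by (rule nn_integral_indicator) simp
  finally show "emeasure ?D A = emeasure ?M A" .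
qed simp

lemma distr_path:
  "distr (path_measure p \<pi>R \<pi>P s) (count_space UNIV) (\<lambda>\<omega>. \<omega> t) =
    measure_pmf (marg (kernel p \<pi>R \<pi>P) s t)"
  (is "?D = measure_pmf ?M")
proof (rule measure_eqI)
  fix A assume "A \<in> sets ?D"
  have "emeasure ?D A = (\<integral>\<^sup>+z. indicator A z \<partial>?D)"
    by simp
  also have "\<dots> = (\<integral>\<^sup>+\<omega>. indicator A (\<omega> t) \<partial>path_measure p \<pi>R \<pi>P s)"
    by (rule nn_integral_distr) measurable
  also have "\<dots> = (\<integral>\<^sup>+z. indicator A z \<partial>?M)"
    by (rule nn_integral_path)
  also have "\<dots> = emeasure ?M A"
    by (rule nn_integral_indicator) simp
  finally show "emeasure ?D A = emeasure ?M A" .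
qed simp

lemma prob_path_nonterminal:
  "\<P>(\<omega> in path_measure p \<pi>R \<pi>P s. \<omega> t \<noteq> Terminal) =
    measure_pmf.prob (marg (kernel p \<pi>R \<pi>P) s t) (- {Terminal})"
proof -
  have "measure_pmf.prob (marg (kernel p \<pi>R \<pi>P) s t) (- {Terminal}) =
      measure (distr (path_measure p \<pi>R \<pi>P s) (count_space UNIV) (\<lambda>\<omega>. \<omega> t)) (- {Terminal})"
    by (simp only: distr_path)
  also have "\<dots> = \<P>(\<omega> in path_measure p \<pi>R \<pi>P s. \<omega> t \<noteq> Terminal)"
    by (subst measure_distr) (auto intro!: arg_cong[where f = "measure _"])
  finally show ?thesis ..
qed

end

section \<open>The game and its one-step lookahead\<close>

lemma expectation_bind_pmf_finite:
  fixes f :: "'b \<Rightarrow> real"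
  assumes "finite (set_pmf M)" and "\<And>x. x \<in> set_pmf M \<Longrightarrow> finite (set_pmf (N x))"
  shows "measure_pmf.expectation (bind_pmf M N) f =
    measure_pmf.expectation M (\<lambda>x. measure_pmf.expectation (N x) f)"
  by (simp add: pmf_expectation_bind[OF assms(1,2) order_refl]
      integral_measure_pmf[OF assms(1)])

lemma finite_states: "finite states"
proof -
  have "finite (live_states)"
  proof (rule finite_subset)
    show "live_states \<subseteq> (\<lambda>(b, c, d, u). Live b c d u) `
        (({0..1} \<times> {0..1} \<times> {0..1}) \<times> ({0..3} \<times> {0..2}) \<times> {0..2} \<times> {0..2})"
      unfolding live_states_def by force
  qed simp
  then show ?thesis
    by (simp add: states_def penult_states_def)
qed

lemma Terminal_in_states [simp]: "Terminal \<in> states"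
  by (simp add: states_def)

text \<open>Lets a pitcher action be held fixed while the runner's action varies;
  \<open>pitcher_acts s 0\<close> later stands for this common set.\<close>

lemma pitcher_acts_indep: "pitcher_acts s a = pitcher_acts s b"
  by (cases s) auto

lemma finite_pitcher_acts [simp]: "finite (pitcher_acts s a)"
  by (cases s) auto

lemma pitcher_acts_nonempty [simp]: "pitcher_acts s a \<noteq> {}"
  by (cases s) auto

lemma compact_runner_acts: "compact (runner_acts s)"
  by (cases s) auto

lemma runner_acts_nonempty [simp]: "runner_acts s \<noteq> {}"
  by (cases s) auto

lemma runner_markovD: "\<pi>R \<in> runner_markov \<Longrightarrow> x \<in> states \<Longrightarrow> \<pi>R t x \<in> runner_acts x"
  unfolding runner_markov_def runner_rules_def by (auto dest: Pi_mem)

lemma pitcher_markovD: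
  "\<pi>P \<in> pitcher_markov \<Longrightarrow> x \<in> states \<Longrightarrow> a \<in> runner_acts x \<Longrightarrow> \<pi>P t (x, a) \<in> pitcher_acts x a"
  unfolding pitcher_markov_def pitcher_rules_def by fastforce

lemma stationary_in_markov:
  "f \<in> runner_rules \<Longrightarrow> (\<lambda>t. f) \<in> runner_markov"
  "pitcher_stationary \<subseteq> pitcher_markov"
  by (auto simp: runner_markov_def pitcher_stationary_def pitcher_markov_def)

lemma reward_bounded: "\<exists>R\<ge>0. \<forall>s\<in>states. \<forall>s'\<in>states. \<bar>reward s s'\<bar> \<le> R"
proof (intro exI conjI ballI)
  let ?A = "(\<lambda>(s, s'). \<bar>reward s s'\<bar>) ` (states \<times> states)"
  have fin: "finite ?A"
    by (simp add: finite_states)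
  show "\<bar>reward s s'\<bar> \<le> Max ?A" if "s \<in> states" "s' \<in> states" for s s'
    by (rule Max_ge[OF fin]) (use that in force)
  show "0 \<le> Max ?A"
    by (rule order_trans[OF abs_ge_zero Max_ge[OF fin]],
        rule image_eqI[where x = "(Terminal, Terminal)"]) simp_all
qed

text \<open>The pitcher's action stays explicit, so that minima in \<open>one_step\<close> can be
  compared action by action.\<close>

definition lookahead :: "(state \<Rightarrow> real \<Rightarrow> real \<Rightarrow> state pmf) \<Rightarrow> (state \<Rightarrow> real) \<Rightarrow>
    state \<Rightarrow> real \<Rightarrow> real \<Rightarrow> real" where
  "lookahead p v s a a' = (\<Sum>s'\<in>states. (reward s s' + v s') * pmf (p s a a') s')"

lemma one_step_eq_Min: "one_step p v s a = Min (lookahead p v s a ` pitcher_acts s a)"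
  by (simp add: one_step_def lookahead_def[abs_def])

locale game =
  fixes p :: "state \<Rightarrow> real \<Rightarrow> real \<Rightarrow> state pmf"
  assumes law: "transition_law p"
begin

lemma set_pmf_transition:
  assumes "s \<in> states" "a \<in> runner_acts s" "a' \<in> pitcher_acts s a"
  shows "set_pmf (p s a a') \<subseteq> states"
  using law assms unfolding transition_law_def by blast

lemma expectation_transition:
  assumes "s \<in> states" "a \<in> runner_acts s" "a' \<in> pitcher_acts s a"
  shows "measure_pmf.expectation (p s a a') f = (\<Sum>s'\<in>states. f s' * pmf (p s a a') s')"
  using set_pmf_transition[OF assms] by (intro integral_measure_pmf_real[OF finite_states]) auto

lemma lookahead_eq_expectation:
  assumes "s \<in> states" "a \<in> runner_acts s" "a' \<in> pitcher_acts s a"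
  shows "lookahead p v s a a' = measure_pmf.expectation (p s a a') (\<lambda>s'. reward s s' + v s')"
  by (simp add: lookahead_def expectation_transition[OF assms])

lemma transition_Terminal:
  assumes "a \<in> runner_acts Terminal" "a' \<in> pitcher_acts Terminal a"
  shows "p Terminal a a' = return_pmf Terminal"
  using law assms Terminal_in_states unfolding transition_law_def by blast

lemma lookahead_Terminal:
  assumes "a \<in> runner_acts Terminal" "a' \<in> pitcher_acts Terminal a"
  shows "lookahead p v Terminal a a' = v Terminal"
  using lookahead_eq_expectation[OF Terminal_in_states assms] transition_Terminal[OF assms] by simp

lemma one_step_attained:
  obtains a' where "a' \<in> pitcher_acts s a" "one_step p v s a = lookahead p v s a a'"
proof -
  have "one_step p v s a \<in> lookahead p v s a ` pitcher_acts s a"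
    unfolding one_step_eq_Min by (rule Min_in) auto
  then show ?thesis
    using that by blast
qed

lemma one_step_le: "a' \<in> pitcher_acts s a \<Longrightarrow> one_step p v s a \<le> lookahead p v s a a'"
  unfolding one_step_eq_Min by (rule Min_le) auto

end

locale game_play = game +
  fixes \<pi>R \<pi>P s
  assumes \<pi>R: "\<pi>R \<in> runner_markov" and \<pi>P: "\<pi>P \<in> pitcher_markov" and s: "s \<in> states"
begin

abbreviation "K \<equiv> kernel p \<pi>R \<pi>P"

abbreviation E :: "nat \<Rightarrow> (state \<Rightarrow> real) \<Rightarrow> real" where
  "E t \<equiv> measure_pmf.expectation (marg K s t)"

lemma set_pmf_kernel: "x \<in> states \<Longrightarrow> set_pmf (K t x) \<subseteq> states"
  unfolding kernel_def by (intro set_pmf_transition runner_markovD[OF \<pi>R] pitcher_markovD[OF \<pi>P])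

lemma set_pmf_marg: "set_pmf (marg K s t) \<subseteq> states"
  proof (induction t)
  case (Suc t)
  then show ?case
    using set_pmf_kernel by (auto simp: subset_iff)
qed (simp add: s)

lemma finite_set_pmf_marg: "finite (set_pmf (marg K s t))"
  using set_pmf_marg finite_states by (rule finite_subset)

lemma finite_set_pmf_kernel: "x \<in> states \<Longrightarrow> finite (set_pmf (K t x))"
  using set_pmf_kernel finite_states by (rule finite_subset)

lemma E_Suc: "E (Suc t) f = E t (\<lambda>x. measure_pmf.expectation (K t x) f)"
  using set_pmf_marg[of t]
  by (simp add: expectation_bind_pmf_finite[OF finite_set_pmf_marg] finite_set_pmf_kernel subset_iff)

lemma E_mono: "(\<And>x. x \<in> states \<Longrightarrow> f x \<le> g x) \<Longrightarrow> E t f \<le> E t g"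
  using set_pmf_marg[of t]
  by (intro integral_mono_AE integrable_measure_pmf_finite finite_set_pmf_marg)
    (auto simp: AE_measure_pmf_iff)

lemma E_cong: "(\<And>x. x \<in> states \<Longrightarrow> f x = g x) \<Longrightarrow> E t f = E t g"
  by (intro antisym E_mono) auto

lemma E_diff: "E t (\<lambda>x. f x - g x) = E t f - E t g"
  by (intro Bochner_Integration.integral_diff integrable_measure_pmf_finite finite_set_pmf_marg)

lemma E_add: "E t (\<lambda>x. f x + g x) = E t f + E t g"
  by (intro Bochner_Integration.integral_add integrable_measure_pmf_finite finite_set_pmf_marg)

lemma abs_E_le: "\<bar>E t f\<bar> \<le> E t (\<lambda>x. \<bar>f x\<bar>)"
  by (rule integral_abs_bound)

end

section \<open>Values under a Lyapunov weight\<close>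

text \<open>The decrease is required for every pair of admissible actions, so \<open>h\<close>
  decays geometrically in mean under all Markov policies, with one common rate.\<close>

locale lyapunov_game = game +
  fixes \<beta> :: real and h :: "state \<Rightarrow> real"
  assumes \<beta>: "0 \<le> \<beta>" "\<beta> < 1"
    and h_Terminal: "h Terminal = 0"
    and h_ge_1: "s \<in> states \<Longrightarrow> s \<noteq> Terminal \<Longrightarrow> 1 \<le> h s"
    and h_decrease: "s \<in> states \<Longrightarrow> a \<in> runner_acts s \<Longrightarrow> a' \<in> pitcher_acts s a \<Longrightarrow>
      measure_pmf.expectation (p s a a') h \<le> \<beta> * h s"
begin

text \<open>There are finitely many states and \<open>h\<close> is at least 1 where \<open>v\<close>
  may be nonzero, so the weighted norm of \<open>v\<close> is finite.\<close>

lemma bounded_by_h: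
  assumes "v Terminal = (0::real)"
  obtains C where "0 \<le> C" "\<And>s. s \<in> states \<Longrightarrow> \<bar>v s\<bar> \<le> C * h s"
proof
  let ?C = "\<Sum>s\<in>states. \<bar>v s\<bar>"
  show C: "0 \<le> ?C"
    by (simp add: sum_nonneg)
  show "\<bar>v s\<bar> \<le> ?C * h s" if "s \<in> states" for s
  proof (cases "s = Terminal")
    case False
    have "\<bar>v s\<bar> \<le> ?C * 1"
      unfolding mult_1_right by (rule member_le_sum) (use that finite_states in auto)
    also have "\<dots> \<le> ?C * h s"
      using C h_ge_1[OF that False] by (rule mult_left_mono[rotated])
    finally show ?thesis .
  qed (simp add: assms h_Terminal)
qed

end

locale lyapunov_play = lyapunov_game + game_play
begin

lemma E_h_le: "E t h \<le> \<beta> ^ t * h s"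
proof (induction t)
  case (Suc t)
  have "E (Suc t) h = E t (\<lambda>x. measure_pmf.expectation (K t x) h)"
    by (rule E_Suc)
  also have "\<dots> \<le> E t (\<lambda>x. \<beta> * h x)"
    by (rule E_mono, unfold kernel_def)
      (intro h_decrease runner_markovD[OF \<pi>R] pitcher_markovD[OF \<pi>P])
  also have "\<dots> \<le> \<beta> * (\<beta> ^ t * h s)"
    using Suc.IH \<beta> by (simp add: mult_left_mono)
  finally show ?case
    by (simp add: mult_ac)
qed simp

text \<open>Supplies the vanishing end term of the telescoping sums over an infinite play.\<close>

lemma E_tendsto_0:
  assumes "v Terminal = 0"
  shows "(\<lambda>t. E t v) \<longlonglongrightarrow> 0"
proof -
  obtain C where C: "0 \<le> C" "\<And>x. x \<in> states \<Longrightarrow> \<bar>v x\<bar> \<le> C * h x"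
    using bounded_by_h[of v, OF assms] by blast
  have "\<bar>E t v\<bar> \<le> C * h s * \<beta> ^ t" for t
  proof -
    have "\<bar>E t v\<bar> \<le> E t (\<lambda>x. \<bar>v x\<bar>)"
      by (rule abs_E_le)
    also have "\<dots> \<le> E t (\<lambda>x. C * h x)"
      by (intro E_mono C)
    also have "\<dots> \<le> C * (\<beta> ^ t * h s)"
      using C E_h_le[of t] by (simp add: mult_left_mono)
    finally show ?thesis
      by (simp add: mult_ac)
  qed
  then have "\<forall>\<^sub>F t in sequentially. norm (E t v) \<le> C * h s * \<beta> ^ t"
    unfolding real_norm_def by (rule always_eventually[OF allI])
  moreover have "(\<lambda>t. C * h s * \<beta> ^ t) \<longlonglongrightarrow> 0"
    using \<beta> by (intro tendsto_mult_right_zero LIMSEQ_power_zero) auto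
  ultimately show ?thesis
    by (rule Lim_null_comparison)
qed

text \<open>Sum and integral may be exchanged because the mean absolute reward of stage
  \<open>t\<close> is at most a constant times \<open>\<beta> ^ t\<close>.\<close>

lemma val_sums: "(\<lambda>t. E t (\<lambda>x. measure_pmf.expectation (K t x) (reward x))) sums val p \<pi>R \<pi>P s"
proof -
  let ?M = "path_measure p \<pi>R \<pi>P s"
  interpret M: prob_space ?M
    by (rule prob_space_path_measure)
  let ?D = "\<lambda>t. bind_pmf (marg K s t) (\<lambda>x. map_pmf (Pair x) (K t x))"
  let ?r = "\<lambda>t \<omega>. reward (\<omega> t) (\<omega> (Suc t))"
  obtain R where R: "0 \<le> R" "\<And>x y. x \<in> states \<Longrightarrow> y \<in> states \<Longrightarrow> \<bar>reward x y\<bar> \<le> R"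
    using reward_bounded by blast
  have meas: "(\<lambda>\<omega>. (\<omega> t, \<omega> (Suc t))) \<in> measurable ?M (count_space UNIV)" for t
    by measurable
  have D: "distr ?M (count_space UNIV) (\<lambda>\<omega>. (\<omega> t, \<omega> (Suc t))) = measure_pmf (?D t)" for t
    by (rule distr_path_pair)
  have finD: "finite (set_pmf (?D t))" for t
    using set_pmf_marg[of t] by (auto intro!: finite_set_pmf_marg finite_set_pmf_kernel)
  \<comment> \<open>Stated for arbitrary \<open>g\<close>, since it serves both the reward and its
    absolute value.\<close>
  have int: "integrable ?M (\<lambda>\<omega>. g (\<omega> t, \<omega> (Suc t)))"
    and intE: "(LINT \<omega>|?M. g (\<omega> t, \<omega> (Suc t))) =
      E t (\<lambda>x. measure_pmf.expectation (K t x) (\<lambda>y. g (x, y)))"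
    for g :: "state \<times> state \<Rightarrow> real" and t
  proof -
    have "integrable (distr ?M (count_space UNIV) (\<lambda>\<omega>. (\<omega> t, \<omega> (Suc t)))) g"
      unfolding D by (rule integrable_measure_pmf_finite[OF finD])
    then show "integrable ?M (\<lambda>\<omega>. g (\<omega> t, \<omega> (Suc t)))"
      by (subst (asm) integrable_distr_eq[OF meas]) auto
    have "(LINT \<omega>|?M. g (\<omega> t, \<omega> (Suc t))) = integral\<^sup>L (measure_pmf (?D t)) g"
      unfolding D[symmetric] by (rule integral_distr[OF meas, symmetric]) simp
    also have "\<dots> = E t (\<lambda>x. measure_pmf.expectation (K t x) (\<lambda>y. g (x, y)))"
      using set_pmf_marg[of t]
      by (subst expectation_bind_pmf_finite) (auto intro!: finite_set_pmf_marg finite_set_pmf_kernel)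
    finally show "(LINT \<omega>|?M. g (\<omega> t, \<omega> (Suc t))) =
        E t (\<lambda>x. measure_pmf.expectation (K t x) (\<lambda>y. g (x, y)))" .
  qed
  have bound: "(LINT \<omega>|?M. norm (?r t \<omega>)) \<le> R * h s * \<beta> ^ t" for t
  proof -
    have "(LINT \<omega>|?M. norm (?r t \<omega>)) = E t (\<lambda>x. measure_pmf.expectation (K t x) (\<lambda>y. \<bar>reward x y\<bar>))"
      using intE[of "\<lambda>(x, y). \<bar>reward x y\<bar>" t] by simp
    also have "\<dots> \<le> E t (\<lambda>x. R * h x)"
    proof (rule E_mono)
      fix x assume x: "x \<in> states"
      show "measure_pmf.expectation (K t x) (\<lambda>y. \<bar>reward x y\<bar>) \<le> R * h x"
      \<comment> \<open>Rewards out of \<open>Terminal\<close> are zero, matching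
        \<open>h Terminal = 0\<close>; elsewhere \<open>h x \<ge> 1\<close> absorbs the bound
        \<open>R\<close>.\<close>
      proof (cases "x = Terminal")
        case False
        have "measure_pmf.expectation (K t x) (\<lambda>y. \<bar>reward x y\<bar>) \<le> R * 1"
          using R(2)[OF x] set_pmf_kernel[OF x, of t] unfolding mult_1_right
          by (intro measure_pmf.integral_le_const integrable_measure_pmf_finite
              finite_set_pmf_kernel[OF x]) (auto simp: AE_measure_pmf_iff)
        also have "\<dots> \<le> R * h x"
          using R(1) h_ge_1[OF x False] by (rule mult_left_mono[rotated])
        finally show ?thesis .
      qed (simp add: h_Terminal)
    qed
    also have "\<dots> \<le> R * (\<beta> ^ t * h s)"
      using R(1) E_h_le[of t] by (simp add: mult_left_mono)
    finally show ?thesis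
      by (simp add: mult_ac)
  qed
  have summ: "summable (\<lambda>t. R * h s * \<beta> ^ t)"
    using \<beta> by (intro summable_mult summable_geometric) auto
  have int_r: "integrable ?M (?r t)" for t
    using int[of "\<lambda>(x, y). reward x y" t] by simp
  have summ_int: "summable (\<lambda>t. LINT \<omega>|?M. norm (?r t \<omega>))"
    using bound by (intro summable_comparison_test'[OF summ, of 0]) auto
  \<comment> \<open>The series of absolute rewards has finite integral, hence it is finite almost
    surely.\<close>
  have "AE \<omega> in ?M. (\<Sum>t. ennreal (norm (?r t \<omega>))) \<noteq> \<infinity>"
  proof (rule nn_integral_PInf_AE)
    show meas_r: "(\<lambda>\<omega>. \<Sum>t. ennreal (norm (?r t \<omega>))) \<in> borel_measurable ?M"
      by measurable
    have "(\<integral>\<^sup>+\<omega>. (\<Sum>t. ennreal (norm (?r t \<omega>))) \<partial>?M) = (\<Sum>t. \<integral>\<^sup>+\<omega>. ennreal (norm (?r t \<omega>)) \<partial>?M)"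
      by (rule nn_integral_suminf) measurable
    also have "\<dots> = (\<Sum>t. ennreal (LINT \<omega>|?M. norm (?r t \<omega>)))"
      by (intro suminf_cong nn_integral_eq_integral integrable_norm int_r) simp
    also have "\<dots> \<noteq> \<infinity>"
      using summ_int by (simp add: suminf_ennreal_eq ennreal_suminf_neq_top)
    finally show "(\<integral>\<^sup>+\<omega>. (\<Sum>t. ennreal (norm (?r t \<omega>))) \<partial>?M) \<noteq> \<infinity>" .
  qed
  then have AE_summ: "AE \<omega> in ?M. summable (\<lambda>t. norm (?r t \<omega>))"
    by eventually_elim (auto intro: summable_suminf_not_top)
  have "(\<lambda>t. LINT \<omega>|?M. ?r t \<omega>) sums (LINT \<omega>|?M. (\<Sum>t. ?r t \<omega>))"
    by (rule sums_integral[OF int_r AE_summ summ_int])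
  then show ?thesis
    using intE[of "\<lambda>(x, y). reward x y"] by (simp add: val_def)
qed

text \<open>The excess of one-step lookahead over \<open>v\<close>, summed along the play, telescopes.\<close>

lemma lookahead_excess_sums:
  assumes "v Terminal = 0"
  shows "(\<lambda>t. E t (\<lambda>x. lookahead p v x (\<pi>R t x) (\<pi>P t (x, \<pi>R t x)) - v x)) sums
    (val p \<pi>R \<pi>P s - v s)"
proof -
  have "E t (\<lambda>x. lookahead p v x (\<pi>R t x) (\<pi>P t (x, \<pi>R t x)) - v x) =
      E t (\<lambda>x. measure_pmf.expectation (K t x) (reward x)) + (E (Suc t) v - E t v)" for t
  proof -
    have "E t (\<lambda>x. lookahead p v x (\<pi>R t x) (\<pi>P t (x, \<pi>R t x))) =
        E t (\<lambda>x. measure_pmf.expectation (K t x) (reward x) + measure_pmf.expectation (K t x) v)"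
    proof (rule E_cong)
      fix x assume x: "x \<in> states"
      have "lookahead p v x (\<pi>R t x) (\<pi>P t (x, \<pi>R t x)) =
          measure_pmf.expectation (K t x) (\<lambda>y. reward x y + v y)"
        unfolding kernel_def
        by (intro lookahead_eq_expectation x runner_markovD[OF \<pi>R] pitcher_markovD[OF \<pi>P])
      also have "\<dots> = measure_pmf.expectation (K t x) (reward x) + measure_pmf.expectation (K t x) v"
        by (intro Bochner_Integration.integral_add integrable_measure_pmf_finite
            finite_set_pmf_kernel x)
      finally show "lookahead p v x (\<pi>R t x) (\<pi>P t (x, \<pi>R t x)) =
          measure_pmf.expectation (K t x) (reward x) + measure_pmf.expectation (K t x) v" .
    qed
    then show ?thesis
      by (simp add: E_diff E_add E_Suc del: marg.simps)
  qed
  moreover have "(\<lambda>t. E t (\<lambda>x. measure_pmf.expectation (K t x) (reward x)) + (E (Suc t) v - E t v))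
      sums (val p \<pi>R \<pi>P s + (0 - E 0 v))"
    by (intro sums_add val_sums telescope_sums E_tendsto_0 assms)
  ultimately show ?thesis
    by simp
qed

text \<open>Every summand of the telescoped excess is nonnegative. The inequality is asked only
  along the actions that the two policies choose.\<close>

lemma le_val:
  assumes "v Terminal = 0"
    and "\<And>t x. x \<in> states \<Longrightarrow> v x \<le> lookahead p v x (\<pi>R t x) (\<pi>P t (x, \<pi>R t x))"
  shows "v s \<le> val p \<pi>R \<pi>P s"
proof -
  have "0 \<le> E t (\<lambda>x. lookahead p v x (\<pi>R t x) (\<pi>P t (x, \<pi>R t x)) - v x)" for t
    using E_mono[of "\<lambda>_. 0" _ t] assms(2) by simp
  from sums_le[OF this sums_zero lookahead_excess_sums[of v, OF assms(1)]] show ?thesis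
    by simp
qed

lemma val_le:
  assumes "v Terminal = 0"
    and "\<And>t x. x \<in> states \<Longrightarrow> lookahead p v x (\<pi>R t x) (\<pi>P t (x, \<pi>R t x)) \<le> v x"
  shows "val p \<pi>R \<pi>P s \<le> v s"
proof -
  have "E t (\<lambda>x. lookahead p v x (\<pi>R t x) (\<pi>P t (x, \<pi>R t x)) - v x) \<le> 0" for t
    using E_mono[of _ "\<lambda>_. 0" t] assms(2) by simp
  from sums_le[OF this lookahead_excess_sums[of v, OF assms(1)] sums_zero] show ?thesis
    by simp
qed

end

section \<open>Existence of a Lyapunov weight\<close>

locale continuous_game = game +
  assumes continuity: "\<And>s (a :: nat \<Rightarrow> real) (a' :: nat \<Rightarrow> real) l l' s'.
    \<lbrakk>s \<in> states; \<And>k. a k \<in> runner_acts s; \<And>k. a' k \<in> pitcher_acts s (a k);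
      a \<longlonglongrightarrow> l; l \<in> runner_acts s; a' \<longlonglongrightarrow> l'; l' \<in> pitcher_acts s l; s' \<in> states\<rbrakk>
    \<Longrightarrow> (\<lambda>k. pmf (p s (a k) (a' k)) s') \<longlonglongrightarrow> pmf (p s l l') s'"
begin

section \<open>Maximizers by continuity and compactness\<close>

lemma continuous_on_transition:
  assumes "s \<in> states" "a' \<in> pitcher_acts s b" "s' \<in> states"
  shows "continuous_on (runner_acts s) (\<lambda>a. pmf (p s a a') s')"
  unfolding continuous_on_sequentially comp_def
proof (intro allI ballI impI, elim conjE)
  fix a l assume a: "\<forall>k. a k \<in> runner_acts s" "l \<in> runner_acts s" "a \<longlonglongrightarrow> l"
  \<comment> \<open>This makes the constant sequence \<open>a'\<close> admissible along any sequence
    of runner actions.\<close>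
  have "a' \<in> pitcher_acts s c" for c
    using assms(2) pitcher_acts_indep[of s b c] by simp
  with a show "(\<lambda>k. pmf (p s (a k) a') s') \<longlonglongrightarrow> pmf (p s l a') s'"
    by (intro continuity assms tendsto_const) auto
qed

lemma continuous_on_transition_sum:
  assumes "s \<in> states" "a' \<in> pitcher_acts s b"
  shows "continuous_on (runner_acts s) (\<lambda>a. \<Sum>s'\<in>states. f s' * pmf (p s a a') s')"
  by (intro continuous_intros continuous_on_transition[OF assms])

text \<open>A minimum of finitely many continuous functions, over an index set that does not move
  with the runner's action; the induction builds the minimum one action at a time.\<close>

lemma continuous_on_one_step:
  assumes "s \<in> states"
  shows "continuous_on (runner_acts s) (one_step p v s)"
proof -
  have "continuous_on (runner_acts s) (\<lambda>a. Min ((\<lambda>a'. lookahead p v s a a') ` A))"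
    if "finite A" "A \<noteq> {}" "A \<subseteq> pitcher_acts s 0" for A
    using that
  proof (induction rule: finite_ne_induct)
    case (insert a' A)
    then show ?case
      using continuous_on_transition_sum[OF assms]
      by (auto simp: lookahead_def intro!: continuous_on_min)
  qed (use continuous_on_transition_sum[OF assms] in \<open>auto simp: lookahead_def\<close>)
  moreover have "one_step p v s = (\<lambda>a. Min ((\<lambda>a'. lookahead p v s a a') ` pitcher_acts s 0))"
    by (rule ext) (metis one_step_eq_Min pitcher_acts_indep)
  ultimately show ?thesis
    by simp
qed

lemma one_step_argmax:
  assumes "s \<in> states"
  shows "\<exists>a\<in>runner_acts s. \<forall>b\<in>runner_acts s. one_step p v s b \<le> one_step p v s a"
  by (intro continuous_attains_sup compact_runner_acts runner_acts_nonempty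
      continuous_on_one_step assms)

text \<open>Both players maximize jointly here, as is needed for a worst case over all policies:
  first over the compact runner set for each pitcher action, then over the finitely many pitcher
  actions.\<close>

lemma expectation_argmax:
  fixes w :: "state \<Rightarrow> real"
  assumes "s \<in> states"
  shows "\<exists>a a'. a \<in> runner_acts s \<and> a' \<in> pitcher_acts s a \<and>
    (\<forall>b\<in>runner_acts s. \<forall>b'\<in>pitcher_acts s b.
      measure_pmf.expectation (p s b b') w \<le> measure_pmf.expectation (p s a a') w)"
proof -
  let ?F = "\<lambda>a a'. \<Sum>s'\<in>states. w s' * pmf (p s a a') s'"
  have "\<exists>a\<in>runner_acts s. \<forall>b\<in>runner_acts s. ?F b a' \<le> ?F a a'" if "a' \<in> pitcher_acts s 0" for a'
    by (intro continuous_attains_sup compact_runner_acts runner_acts_nonempty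
        continuous_on_transition_sum[OF assms that])
  then obtain g where g: "\<And>a'. a' \<in> pitcher_acts s 0 \<Longrightarrow> g a' \<in> runner_acts s"
    "\<And>a' b. a' \<in> pitcher_acts s 0 \<Longrightarrow> b \<in> runner_acts s \<Longrightarrow> ?F b a' \<le> ?F (g a') a'"
    by metis
  obtain a' where a': "a' \<in> pitcher_acts s 0"
    "\<And>b'. b' \<in> pitcher_acts s 0 \<Longrightarrow> ?F (g b') b' \<le> ?F (g a') a'"
  proof -
    let ?G = "(\<lambda>a'. ?F (g a') a') ` pitcher_acts s 0"
    have "Max ?G \<in> ?G"
      by (rule Max_in) auto
    then obtain a' where "a' \<in> pitcher_acts s 0" "Max ?G = ?F (g a') a'"
      by (rule imageE) simp
    moreover have "?F (g b') b' \<le> Max ?G" if "b' \<in> pitcher_acts s 0" for b'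
      by (rule Max_ge) (use that in auto)
    ultimately show ?thesis
      using that by metis
  qed
  show ?thesis
  proof (intro exI conjI ballI)
    show "g a' \<in> runner_acts s"
      by (rule g(1)[OF a'(1)])
    show mem: "a' \<in> pitcher_acts s (g a')"
      using a'(1) pitcher_acts_indep by blast
    fix b b' assume b: "b \<in> runner_acts s" "b' \<in> pitcher_acts s b"
    then have b': "b' \<in> pitcher_acts s 0"
      using pitcher_acts_indep by blast
    show "measure_pmf.expectation (p s b b') w \<le> measure_pmf.expectation (p s (g a') a') w"
      unfolding expectation_transition[OF assms b]
        expectation_transition[OF assms g(1)[OF a'(1)] mem]
      using g(2)[OF b' b(1)] a'(2)[OF b'] by linarith
  qed
qed

text \<open>With \<open>W k s\<close> the largest probability of surviving \<open>k\<close> stages from \<open>s\<close>, which is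
  attained by Markov policies, the weight is \<open>h = (\<Sum>k<m. W k / \<beta> ^ k)\<close>, where \<open>\<beta> ^ m\<close> bounds
  \<open>W m\<close>.\<close>

lemma lyapunov_exists:
  assumes "(SUP (\<pi>R, \<pi>P, s) \<in> runner_markov \<times> pitcher_markov \<times> states.
      \<P>(\<omega> in path_measure p \<pi>R \<pi>P s. \<omega> m \<noteq> Terminal)) < 1"
  obtains \<beta> h where "lyapunov_game p \<beta> h"
proof -
  \<comment> \<open>Raising the supremum to at least \<open>1 / 2\<close> makes
    \<open>\<rho>\<close> positive, so that its root can be divided by.\<close>
  define \<rho> where "\<rho> = max (1 / 2) (SUP (\<pi>R, \<pi>P, s) \<in> runner_markov \<times> pitcher_markov \<times> states.
      \<P>(\<omega> in path_measure p \<pi>R \<pi>P s. \<omega> m \<noteq> Terminal))"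
  have \<rho>: "0 < \<rho>" "\<rho> < 1"
    using assms by (auto simp: \<rho>_def)
  have survival_le: "measure_pmf.prob (marg (kernel p \<pi>R \<pi>P) s m) (- {Terminal}) \<le> \<rho>"
    if "\<pi>R \<in> runner_markov" "\<pi>P \<in> pitcher_markov" "s \<in> states" for \<pi>R \<pi>P s
  proof -
    let ?S = "\<lambda>(\<pi>R, \<pi>P, s). \<P>(\<omega> in path_measure p \<pi>R \<pi>P s. \<omega> m \<noteq> Terminal)"
    \<comment> \<open>A real supremum dominates its members only for a bounded family; probabilities
      are bounded by 1.\<close>
    have "?S (\<pi>R, \<pi>P, s) \<le> (SUP z \<in> runner_markov \<times> pitcher_markov \<times> states. ?S z)"
    proof (rule cSUP_upper)
      show "bdd_above (?S ` (runner_markov \<times> pitcher_markov \<times> states))"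
        by (rule bdd_aboveI[of _ 1])
          (auto intro!: prob_space.prob_le_1[OF prob_space_path_measure])
    qed (use that in simp)
    then show ?thesis
      using prob_path_nonterminal[of p \<pi>R \<pi>P s m] by (simp add: \<rho>_def)
  qed
  obtain A A' :: "(state \<Rightarrow> real) \<Rightarrow> state \<Rightarrow> real" where A: "\<And>w s. s \<in> states \<Longrightarrow> A w s \<in> runner_acts s"
      "\<And>w s. s \<in> states \<Longrightarrow> A' w s \<in> pitcher_acts s (A w s)"
      "\<And>w s b b'. s \<in> states \<Longrightarrow> b \<in> runner_acts s \<Longrightarrow> b' \<in> pitcher_acts s b \<Longrightarrow>
        measure_pmf.expectation (p s b b') w \<le> measure_pmf.expectation (p s (A w s) (A' w s)) w"
  proof -
    \<comment> \<open>Both actions are packed into one pair, so that a single choice picks them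
      consistently.\<close>
    define Q where "Q w s z \<longleftrightarrow> fst z \<in> runner_acts s \<and> snd z \<in> pitcher_acts s (fst z) \<and>
        (\<forall>b\<in>runner_acts s. \<forall>b'\<in>pitcher_acts s b.
          measure_pmf.expectation (p s b b') w \<le> measure_pmf.expectation (p s (fst z) (snd z)) w)"
      for w :: "state \<Rightarrow> real" and s and z :: "real \<times> real"
    have "\<exists>z. Q w s z" if "s \<in> states" for w s
      using expectation_argmax[OF that, of w] by (auto simp: Q_def)
    then have "Q w s (SOME z. Q w s z)" if "s \<in> states" for w s
      using that by (blast intro: someI_ex)
    then show ?thesis
      using that[of "\<lambda>w s. fst (SOME z. Q w s z)" "\<lambda>w s. snd (SOME z. Q w s z)"]
      unfolding Q_def by blast
  qed
  \<comment> \<open>The chosen pitcher action is legal after any runner action, so ignoring that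
    action gives a valid decision rule.\<close>
  have A'_acts: "A' w s \<in> pitcher_acts s b" if "s \<in> states" for w s b
    using A(2)[OF that, of w] pitcher_acts_indep[of s b "A w s"] by simp
  \<comment> \<open>Dynamic programming for survival: maximize the mean of the remaining survival
    probability over both actions.\<close>
  define W where "W = rec_nat (\<lambda>s. of_bool (s \<noteq> Terminal))
    (\<lambda>_ w s. measure_pmf.expectation (p s (A w s) (A' w s)) w)"
  have W_0: "W 0 s = of_bool (s \<noteq> Terminal)" for s
    by (simp add: W_def)
  have W_Suc: "W (Suc n) s = measure_pmf.expectation (p s (A (W n) s) (A' (W n) s)) (W n)" for n s
    by (simp add: W_def)
  \<comment> \<open>One pair of policies serves all initial states, which is what prepending a
    decision in the induction requires.\<close>
  have W_policies: "\<exists>\<pi>R\<in>runner_markov. \<exists>\<pi>P\<in>pitcher_markov. \<forall>s\<in>states.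
    W n s = measure_pmf.prob (marg (kernel p \<pi>R \<pi>P) s n) (- {Terminal})" for n
  proof (induction n)
    case 0
    have "(\<lambda>_. A (W 0)) \<in> runner_markov"
      using A(1) by (auto simp: runner_markov_def runner_rules_def)
    moreover have "(\<lambda>_ (x, a). A' (W 0) x) \<in> pitcher_markov"
      using A'_acts by (auto simp: pitcher_markov_def pitcher_rules_def)
    ultimately show ?case
      by (intro bexI ballI) (auto simp: W_0 indicator_def)
  next
    case (Suc n)
    then obtain \<pi>R \<pi>P where \<pi>: "\<pi>R \<in> runner_markov" "\<pi>P \<in> pitcher_markov"
      and W_n: "\<And>s. s \<in> states \<Longrightarrow>
        W n s = measure_pmf.prob (marg (kernel p \<pi>R \<pi>P) s n) (- {Terminal})"
      by blast
    \<comment> \<open>The maximizing decision for \<open>W n\<close> comes first, then the policies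
      for \<open>n\<close> stages, delayed by one.\<close>
    define \<pi>R' where "\<pi>R' t = (case t of 0 \<Rightarrow> A (W n) | Suc t \<Rightarrow> \<pi>R t)" for t
    define \<pi>P' where "\<pi>P' t = (case t of 0 \<Rightarrow> \<lambda>(x, a). A' (W n) x | Suc t \<Rightarrow> \<pi>P t)" for t
    have "\<pi>R' \<in> runner_markov"
      using A(1) \<pi>(1)
      by (auto simp: runner_markov_def runner_rules_def \<pi>R'_def split: nat.split)
    moreover have "\<pi>P' \<in> pitcher_markov"
      using A'_acts \<pi>(2)
      by (auto simp: pitcher_markov_def pitcher_rules_def \<pi>P'_def split: nat.split)
    moreover have "W (Suc n) s =
      measure_pmf.prob (marg (kernel p \<pi>R' \<pi>P') s (Suc n)) (- {Terminal})" if s: "s \<in> states" for s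
    proof -
      let ?q = "p s (A (W n) s) (A' (W n) s)"
      have K: "kernel p \<pi>R' \<pi>P' 0 s = ?q" "(\<lambda>t. kernel p \<pi>R' \<pi>P' (Suc t)) = kernel p \<pi>R \<pi>P"
        by (auto simp: kernel_def fun_eq_iff \<pi>R'_def \<pi>P'_def)
      have q: "set_pmf ?q \<subseteq> states"
        by (intro set_pmf_transition s A)
      have fin: "finite (set_pmf (marg (kernel p \<pi>R \<pi>P) x n))" if "x \<in> set_pmf ?q" for x
        using q that \<pi>
        by (intro game_play.finite_set_pmf_marg) (auto simp: game_play_def game_play_axioms_def game_axioms)
      have "measure_pmf.prob (marg (kernel p \<pi>R' \<pi>P') s (Suc n)) (- {Terminal}) =
          measure_pmf.expectation (bind_pmf ?q (\<lambda>x. marg (kernel p \<pi>R \<pi>P) x n))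
            (indicator (- {Terminal}))"
        by (simp only: marg_shift K) simp
      also have "\<dots> = measure_pmf.expectation ?q
          (\<lambda>x. measure_pmf.prob (marg (kernel p \<pi>R \<pi>P) x n) (- {Terminal}))"
        using finite_subset[OF q finite_states] fin by (subst expectation_bind_pmf_finite) auto
      also have "\<dots> = measure_pmf.expectation ?q (W n)"
        using W_n q by (intro integral_cong_AE) (auto simp: AE_measure_pmf_iff)
      finally show ?thesis
        by (simp add: W_Suc)
    qed
    ultimately show ?case
      by blast
  qed
  have W_nonneg: "0 \<le> W n s" if "s \<in> states" for n s
    using W_policies[of n] that by auto
  have W_m_le: "W m s \<le> \<rho>" if "s \<in> states" for s
    using W_policies[of m] that survival_le by auto
  have W_Terminal: "W n Terminal = 0" for n
  proof (induction n)
    case (Suc n)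
    then show ?case
      using transition_Terminal[OF A(1,2)[OF Terminal_in_states]]
      by (simp add: W_Suc)
  qed (simp add: W_0)
  \<comment> \<open>With no stage played a penultimate state survives surely, contradicting
    \<open>\<rho> < 1\<close>. Positivity of \<open>m\<close> is needed for the root and for the
    term \<open>k = 0\<close> of \<open>h\<close>.\<close>
  have "m \<noteq> 0"
  proof
    assume "m = 0"
    moreover have "Penult 0 \<in> states"
      by (simp add: states_def penult_states_def)
    ultimately show False
      using W_m_le[of "Penult 0"] \<rho>(2) by (simp add: W_0)
  qed
  define \<beta> where "\<beta> = root m \<rho>"
  have \<beta>: "0 < \<beta>" "\<beta> < 1" "\<beta> ^ m = \<rho>"
    using \<rho> \<open>m \<noteq> 0\<close> by (auto simp: \<beta>_def)
  define h where "h s = (\<Sum>k<m. W k s / \<beta> ^ k)" for s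
  have "lyapunov_game p \<beta> h"
  proof
    show "0 \<le> \<beta>" "\<beta> < 1"
      using \<beta> by auto
    show "h Terminal = 0"
      by (simp add: h_def W_Terminal)
  next
    fix s assume s: "s \<in> states" "s \<noteq> Terminal"
    have "W 0 s / \<beta> ^ 0 \<le> h s"
      unfolding h_def using \<open>m \<noteq> 0\<close> W_nonneg[OF s(1)] \<beta>(1) by (intro member_le_sum) auto
    then show "1 \<le> h s"
      using s(2) by (simp add: W_0)
  next
    fix s a a' assume s: "s \<in> states" and a: "a \<in> runner_acts s" "a' \<in> pitcher_acts s a"
    have fin: "finite (set_pmf (p s a a'))"
      using set_pmf_transition[OF s a] finite_states by (rule finite_subset)
    have "measure_pmf.expectation (p s a a') h =
        (\<Sum>k<m. measure_pmf.expectation (p s a a') (W k) / \<beta> ^ k)"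
      unfolding h_def by (subst Bochner_Integration.integral_sum)
        (auto intro: integrable_measure_pmf_finite[OF fin])
    \<comment> \<open>No pair of actions beats the maximizing pair that defines
      \<open>W (Suc k)\<close>.\<close>
    also have "\<dots> \<le> (\<Sum>k<m. W (Suc k) s / \<beta> ^ k)"
      using A(3)[OF s a] \<beta>(1) by (intro sum_mono divide_right_mono) (auto simp: W_Suc)
    also have "\<dots> = \<beta> * (\<Sum>k<m. W (Suc k) s / \<beta> ^ Suc k)"
      using \<beta>(1) by (simp add: sum_distrib_left)
    \<comment> \<open>The index shift gains the term \<open>k = m\<close> and loses the term
      \<open>k = 0\<close>.\<close>
    also have "(\<Sum>k<m. W (Suc k) s / \<beta> ^ Suc k) = h s + W m s / \<beta> ^ m - W 0 s"
      using sum.lessThan_Suc_shift[of "\<lambda>k. W k s / \<beta> ^ k" m] by (simp add: h_def)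
    \<comment> \<open>Off \<open>Terminal\<close> the left side is at most
      \<open>\<rho> / \<rho> = 1 = W 0 s\<close>; at \<open>Terminal\<close> both sides vanish. So
      the exchanged terms do not increase \<open>h s\<close>.\<close>
    also have "W m s / \<beta> ^ m \<le> W 0 s"
      using W_m_le[OF s] \<rho>(1) W_Terminal[of m] by (auto simp: \<beta>(3) W_0)
    finally show "measure_pmf.expectation (p s a a') h \<le> \<beta> * h s"
      using \<beta>(1) by (simp add: mult_left_mono)
  qed
  then show ?thesis
    by (rule that)
qed

end

section \<open>Bellman equations and policy iteration\<close>

lemma one_step_cong:
  "(\<And>x. x \<in> states \<Longrightarrow> u x = w x) \<Longrightarrow> one_step p u s a = one_step p w s a"
  by (simp add: one_step_def)

lemma (in game) one_step_Terminal:
  assumes "a \<in> runner_acts Terminal"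
  shows "one_step p v Terminal a = v Terminal"
  using one_step_attained[of Terminal a v] lookahead_Terminal[OF assms] by metis

text \<open>A best response of the pitcher to \<open>v\<close>. A minimizer exists at every pair, as
  the pitcher's action sets are always finite and nonempty.\<close>

definition greedy :: "(state \<Rightarrow> real \<Rightarrow> real \<Rightarrow> state pmf) \<Rightarrow> (state \<Rightarrow> real) \<Rightarrow> state \<times> real \<Rightarrow> real" where
  "greedy p v = (\<lambda>(s, a). SOME a'. a' \<in> pitcher_acts s a \<and> one_step p v s a = lookahead p v s a a')"

lemma (in game) greedy:
  "greedy p v (s, a) \<in> pitcher_acts s a"
  "lookahead p v s a (greedy p v (s, a)) = one_step p v s a"
proof -
  have "\<exists>a'. a' \<in> pitcher_acts s a \<and> one_step p v s a = lookahead p v s a a'"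
    using one_step_attained[of s a v] by metis
  from someI_ex[OF this] show "greedy p v (s, a) \<in> pitcher_acts s a"
    "lookahead p v s a (greedy p v (s, a)) = one_step p v s a"
    by (auto simp: greedy_def)
qed

lemma (in game) greedy_stationary: "(\<lambda>t. greedy p v) \<in> pitcher_stationary"
  using greedy(1) by (auto simp: pitcher_stationary_def pitcher_rules_def)

context lyapunov_game
begin

lemma lyapunov_playI:
  assumes "\<pi>R \<in> runner_markov" "\<pi>P \<in> pitcher_markov" "s \<in> states"
  shows "lyapunov_play p \<beta> h \<pi>R \<pi>P s"
  using assms by unfold_locales

text \<open>One-sided contraction: the excess \<open>C * h\<close> is averaged by the transition and
  shrinks by \<open>h_decrease\<close>. The case \<open>C = 0\<close> is monotonicity.\<close>

lemma lookahead_le: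
  assumes C: "0 \<le> C" and uw: "\<And>x. x \<in> states \<Longrightarrow> u x \<le> w x + C * h x"
    and s: "s \<in> states" "a \<in> runner_acts s" "a' \<in> pitcher_acts s a"
  shows "lookahead p u s a a' \<le> lookahead p w s a a' + \<beta> * C * h s"
proof -
  have "lookahead p u s a a' \<le>
      (\<Sum>x\<in>states. (reward s x + w x) * pmf (p s a a') x + C * (h x * pmf (p s a a') x))"
    unfolding lookahead_def
  proof (rule sum_mono)
    fix x assume "x \<in> states"
    then have "(reward s x + u x) * pmf (p s a a') x \<le> (reward s x + (w x + C * h x)) * pmf (p s a a') x"
      using uw by (intro mult_right_mono add_left_mono) auto
    then show "(reward s x + u x) * pmf (p s a a') x \<le>
        (reward s x + w x) * pmf (p s a a') x + C * (h x * pmf (p s a a') x)"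
      by (simp add: algebra_simps)
  qed
  also have "\<dots> = lookahead p w s a a' + C * measure_pmf.expectation (p s a a') h"
    by (simp add: lookahead_def expectation_transition[OF s] sum.distrib sum_distrib_left)
  also have "\<dots> \<le> lookahead p w s a a' + C * (\<beta> * h s)"
    using C h_decrease[OF s] by (intro add_left_mono mult_left_mono)
  finally show ?thesis
    by (simp add: mult_ac)
qed

text \<open>The minimum for \<open>u\<close> is bounded by its lookahead at the minimizer for
  \<open>w\<close>, where the two lookaheads are comparable.\<close>

lemma one_step_le_one_step:
  assumes "0 \<le> C" "\<And>x. x \<in> states \<Longrightarrow> u x \<le> w x + C * h x"
    and "s \<in> states" "a \<in> runner_acts s"
  shows "one_step p u s a \<le> one_step p w s a + \<beta> * C * h s"
  using one_step_le[OF greedy(1), of u s a w] lookahead_le[OF assms greedy(1), of w]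
  by (simp add: greedy(2))

text \<open>Banach iteration in the weighted norm. Starting from zero keeps all iterates zero at
  \<open>Terminal\<close>, where the weight vanishes.\<close>

lemma weighted_contraction_fixed_point:
  fixes T :: "(state \<Rightarrow> real) \<Rightarrow> state \<Rightarrow> real"
  assumes contr: "\<And>u w C s. 0 \<le> C \<Longrightarrow> (\<And>x. x \<in> states \<Longrightarrow> u x \<le> w x + C * h x) \<Longrightarrow> s \<in> states \<Longrightarrow>
      T u s \<le> T w s + \<beta> * C * h s"
    and Terminal: "\<And>v. T v Terminal = v Terminal"
  obtains v where "v Terminal = 0" "\<And>s. s \<in> states \<Longrightarrow> T v s = v s"
proof -
  have contr_abs: "\<bar>T u s - T w s\<bar> \<le> \<beta> * C * h s"
    if "0 \<le> C" "\<And>x. x \<in> states \<Longrightarrow> \<bar>u x - w x\<bar> \<le> C * h x" "s \<in> states" for u w C s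
  proof -
    have uw: "u x \<le> w x + C * h x" and wu: "w x \<le> u x + C * h x" if "x \<in> states" for x
      using \<open>\<And>x. x \<in> states \<Longrightarrow> \<bar>u x - w x\<bar> \<le> C * h x\<close>[OF that] by linarith+
    have "T u s \<le> T w s + \<beta> * C * h s" "T w s \<le> T u s + \<beta> * C * h s"
      by (intro contr that(1,3) uw wu; assumption)+
    then show ?thesis
      by (simp add: abs_le_iff)
  qed
  define V where "V n = (T ^^ n) (\<lambda>_. 0)" for n
  have V_Suc: "V (Suc n) = T (V n)" for n
    by (simp add: V_def)
  have V_Terminal: "V n Terminal = 0" for n
    by (induction n) (simp_all add: V_def Terminal)
  \<comment> \<open>As \<open>V 0\<close> is zero, \<open>C\<close> measures the first
    increment.\<close>
  obtain C where C: "0 \<le> C" "\<And>s. s \<in> states \<Longrightarrow> \<bar>V 1 s\<bar> \<le> C * h s"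
    using bounded_by_h[of "V 1", OF V_Terminal] by blast
  have step: "\<bar>V (Suc n) s - V n s\<bar> \<le> \<beta> ^ n * C * h s" if "s \<in> states" for n s
    using that
  proof (induction n arbitrary: s)
    case 0
    then show ?case
      using C(2) by (simp add: V_def)
  next
    case (Suc n)
    show ?case
    proof -
      have "\<bar>T (V (Suc n)) s - T (V n) s\<bar> \<le> \<beta> * (\<beta> ^ n * C) * h s"
        using C(1) \<beta>(1) by (intro contr_abs Suc.IH Suc.prems) simp_all
      then show ?thesis
        by (simp add: V_Suc mult.assoc)
    qed
  qed
  have "convergent (\<lambda>n. V n s)" if s: "s \<in> states" for s
  proof -
    have "summable (\<lambda>n. \<beta> ^ n * (C * h s))"
      using \<beta> by (intro summable_mult2 summable_geometric) auto
    then have "summable (\<lambda>n. V (Suc n) s - V n s)"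
      by (rule summable_comparison_test'[where N = 0]) (use step[OF s] in \<open>simp add: mult.assoc\<close>)
    then have "convergent (\<lambda>n. \<Sum>k<n. V (Suc k) s - V k s)"
      by (simp add: summable_iff_convergent)
    then have "convergent (\<lambda>n. (\<Sum>k<n. V (Suc k) s - V k s) + V 0 s)"
      by (rule convergent_add[OF _ convergent_const])
    then show ?thesis
      by (simp add: sum_lessThan_telescope[of "\<lambda>k. V k s"])
  qed
  then have lim: "(\<lambda>n. V n s) \<longlonglongrightarrow> lim (\<lambda>n. V n s)" if "s \<in> states" for s
    using that by (simp add: convergent_LIMSEQ_iff)
  define v where "v s = lim (\<lambda>n. V n s)" for s
  have v_Terminal: "v Terminal = 0"
    by (simp add: v_def V_Terminal)
  have "T v s = v s" if s: "s \<in> states" for s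
  proof -
    \<comment> \<open>The summed distance dominates the weighted one because \<open>h\<close> is at
      least 1 off \<open>Terminal\<close>, and it tends to zero as a finite sum; so
      \<open>T v\<close> is the limit of \<open>T (V n)\<close>.\<close>
    let ?d = "\<lambda>n. \<Sum>x\<in>states. \<bar>v x - V n x\<bar>"
    have d: "?d \<longlonglongrightarrow> 0"
    proof (rule tendsto_null_sum)
      fix x assume "x \<in> states"
      then have "(\<lambda>n. v x - V n x) \<longlonglongrightarrow> v x - v x"
        unfolding v_def by (intro tendsto_diff tendsto_const lim)
      then show "(\<lambda>n. \<bar>v x - V n x\<bar>) \<longlonglongrightarrow> 0"
        by (intro tendsto_rabs_zero) simp
    qed
    have "\<bar>T v s - V (Suc n) s\<bar> \<le> \<beta> * ?d n * h s" for n
      unfolding V_Suc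
    proof (rule contr_abs[OF _ _ s])
      show "0 \<le> ?d n"
        by (simp add: sum_nonneg)
      show "\<bar>v x - V n x\<bar> \<le> ?d n * h x" if x: "x \<in> states" for x
      proof (cases "x = Terminal")
        case False
        have "\<bar>v x - V n x\<bar> \<le> ?d n * 1"
          unfolding mult_1_right by (rule member_le_sum) (use x finite_states in auto)
        also have "\<dots> \<le> ?d n * h x"
          using h_ge_1[OF x False] by (intro mult_left_mono) (auto simp: sum_nonneg)
        finally show ?thesis .
      qed (simp add: v_Terminal V_Terminal h_Terminal)
    qed
    then have "\<forall>\<^sub>F n in sequentially. norm (T v s - V (Suc n) s) \<le> \<beta> * ?d n * h s"
      unfolding real_norm_def by (rule always_eventually[OF allI])
    moreover have "(\<lambda>n. \<beta> * ?d n * h s) \<longlonglongrightarrow> 0"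
      by (intro tendsto_mult_left_zero tendsto_mult_right_zero d)
    ultimately have "(\<lambda>n. T v s - V (Suc n) s) \<longlonglongrightarrow> 0"
      by (rule Lim_null_comparison)
    moreover have "(\<lambda>n. T v s - V (Suc n) s) \<longlonglongrightarrow> T v s - v s"
      unfolding v_def by (intro tendsto_diff tendsto_const LIMSEQ_Suc lim s)
    ultimately have "T v s - v s = 0"
      by (rule LIMSEQ_unique[symmetric])
    then show ?thesis
      by simp
  qed
  with v_Terminal show ?thesis
    by (rule that)
qed

text \<open>Makes the real infimum over pitchers meaningful: a multiple \<open>- C * h\<close> lies
  below its own lookahead under all actions, hence below every value.\<close>

lemma val_bdd_below:
  assumes s: "s \<in> states" and \<pi>R: "\<pi>R \<in> runner_markov"
  shows "bdd_below ((\<lambda>\<pi>P. val p \<pi>R \<pi>P s) ` pitcher_markov)"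
proof -
  obtain R where R: "0 \<le> R" "\<And>x y. x \<in> states \<Longrightarrow> y \<in> states \<Longrightarrow> \<bar>reward x y\<bar> \<le> R"
    using reward_bounded by blast
  \<comment> \<open>Chosen to solve \<open>R = C - \<beta> * C\<close>: the loss of one stage equals
    what the contraction gives back.\<close>
  define C where "C = R / (1 - \<beta>)"
  have C: "0 \<le> C" "R = C - \<beta> * C"
  proof -
    show "0 \<le> C"
      using R(1) \<beta> by (simp add: C_def)
    have "R = C * (1 - \<beta>)"
      using \<beta> by (simp add: C_def)
    then show "R = C - \<beta> * C"
      by (simp add: algebra_simps)
  qed
  have sub: "- C * h x \<le> lookahead p (\<lambda>x. - C * h x) x a a'"
    if x: "x \<in> states" "a \<in> runner_acts x" "a' \<in> pitcher_acts x a" for x a a'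
  proof -
    have "- R * h x \<le> lookahead p (\<lambda>_. 0) x a a'"
    proof (cases "x = Terminal")
      case True
      then show ?thesis
        using x lookahead_Terminal h_Terminal by simp
    next
      case False
      have "- R * h x \<le> - R"
        using R(1) h_ge_1[OF x(1) False] by (simp add: mult_le_cancel_left1)
      also have "\<dots> \<le> measure_pmf.expectation (p x a a') (reward x)"
        using set_pmf_transition[OF x] R(2)[OF x(1)] finite_subset[OF _ finite_states]
        by (intro measure_pmf.integral_ge_const integrable_measure_pmf_finite)
          (auto simp: AE_measure_pmf_iff abs_le_iff minus_le_iff)
      finally show ?thesis
        by (simp add: lookahead_eq_expectation[OF x])
    qed
    moreover have "lookahead p (\<lambda>_. 0) x a a' \<le>
        lookahead p (\<lambda>x. - C * h x) x a a' + \<beta> * C * h x"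
      by (intro lookahead_le C x) simp
    ultimately show ?thesis
      using C(2) by (simp add: algebra_simps)
  qed
  have "- C * h s \<le> val p \<pi>R \<pi>P s" if \<pi>P: "\<pi>P \<in> pitcher_markov" for \<pi>P
  proof -
    interpret lyapunov_play p \<beta> h \<pi>R \<pi>P s
      by (intro lyapunov_playI assms \<pi>P)
    show ?thesis
      by (rule le_val[of "\<lambda>x. - C * h x"])
        (auto simp only: h_Terminal mult_zero_right
          intro!: sub runner_markovD[OF \<pi>R] pitcher_markovD[OF \<pi>P])
  qed
  then show ?thesis
    by (rule bdd_belowI2)
qed

section \<open>Bellman equations for a fixed runner rule and for the game\<close>

lemma rule_fixed_point:
  assumes f: "f \<in> runner_rules"
  obtains v where "v Terminal = 0" "\<And>s. s \<in> states \<Longrightarrow> one_step p v s (f s) = v s"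
proof (rule weighted_contraction_fixed_point[of "\<lambda>v s. one_step p v s (f s)"])
  have f_acts: "f x \<in> runner_acts x" if "x \<in> states" for x
    using f that by (auto simp: runner_rules_def)
  show "one_step p v Terminal (f Terminal) = v Terminal" for v
    by (intro one_step_Terminal f_acts) simp
  show "one_step p u s (f s) \<le> one_step p w s (f s) + \<beta> * C * h s"
    if "0 \<le> C" "\<And>x. x \<in> states \<Longrightarrow> u x \<le> w x + C * h x" "s \<in> states" for u w C s
    by (intro one_step_le_one_step that f_acts)
qed (use that in blast)

text \<open>Against any Markov pitcher \<open>v\<close> is below its lookahead, and the greedy
  pitcher gives equality. So a stationary response attains the minimum even among Markov
  pitchers.\<close>

lemma rule_fixed_point_value:
  assumes f: "f \<in> runner_rules" and v: "v Terminal = 0" "\<And>s. s \<in> states \<Longrightarrow> one_step p v s (f s) = v s"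
    and s: "s \<in> states"
  shows "val p (\<lambda>t. f) (\<lambda>t. greedy p v) s = v s"
    and "\<pi>P \<in> pitcher_markov \<Longrightarrow> v s \<le> val p (\<lambda>t. f) \<pi>P s"
    and "rule_val p f s = v s"
proof -
  have f_acts: "f x \<in> runner_acts x" if "x \<in> states" for x
    using f that by (auto simp: runner_rules_def)
  have g: "(\<lambda>t. greedy p v) \<in> pitcher_markov"
    using greedy_stationary stationary_in_markov(2) by blast
  show lower: "v s \<le> val p (\<lambda>t. f) \<pi>P s" if \<pi>P: "\<pi>P \<in> pitcher_markov" for \<pi>P
  proof -
    interpret lyapunov_play p \<beta> h "\<lambda>t. f" \<pi>P s
      by (intro lyapunov_playI stationary_in_markov f \<pi>P s)
    show ?thesis
      using v one_step_le[OF pitcher_markovD[OF \<pi>P]] f_acts by (intro le_val) metis+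
  qed
  interpret lyapunov_play p \<beta> h "\<lambda>t. f" "\<lambda>t. greedy p v" s
    by (intro lyapunov_playI stationary_in_markov f g s)
  have "val p (\<lambda>t. f) (\<lambda>t. greedy p v) s \<le> v s"
    using v by (intro val_le) (simp_all add: greedy(2))
  with lower[OF g] show attained: "val p (\<lambda>t. f) (\<lambda>t. greedy p v) s = v s"
    by simp
  show "rule_val p f s = v s"
    unfolding rule_val_def
  proof (rule cInf_eq_minimum)
    show "v s \<in> (\<lambda>\<pi>P. val p (\<lambda>t. f) \<pi>P s) ` pitcher_stationary"
      using greedy_stationary attained by (metis imageI)
    show "v s \<le> y" if "y \<in> (\<lambda>\<pi>P. val p (\<lambda>t. f) \<pi>P s) ` pitcher_stationary" for y
      using that lower stationary_in_markov(2) by blast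
  qed
qed

lemma rule_val_Terminal:
  assumes "f \<in> runner_rules"
  shows "rule_val p f Terminal = 0"
  using rule_fixed_point[OF assms] rule_fixed_point_value(3)[OF assms _ _ Terminal_in_states]
  by metis

lemma rule_val_fixed_point:
  assumes f: "f \<in> runner_rules" and s: "s \<in> states"
  shows "one_step p (rule_val p f) s (f s) = rule_val p f s"
proof -
  obtain v where v: "v Terminal = 0" "\<And>s. s \<in> states \<Longrightarrow> one_step p v s (f s) = v s"
    using rule_fixed_point[OF f] by blast
  then have "rule_val p f x = v x" if "x \<in> states" for x
    using rule_fixed_point_value(3)[OF f _ _ that] by blast
  then show ?thesis
    using v(2)[OF s] s one_step_cong[of "rule_val p f" v] by metis
qed

lemma rule_val_le_val:
  assumes "f \<in> runner_rules" "s \<in> states" "\<pi>P \<in> pitcher_markov"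
  shows "rule_val p f s \<le> val p (\<lambda>t. f) \<pi>P s"
  by (intro rule_fixed_point_value(2) rule_val_Terminal rule_val_fixed_point assms)

lemma rule_val_attained:
  assumes "f \<in> runner_rules" "s \<in> states"
  shows "val p (\<lambda>t. f) (\<lambda>t. greedy p (rule_val p f)) s = rule_val p f s"
  by (intro rule_fixed_point_value(1) rule_val_Terminal rule_val_fixed_point assms)

text \<open>Policy improvement: play \<open>f\<close> against the stationary response attaining its
  value; \<open>v\<close> stays below its lookahead along this play.\<close>

lemma rule_val_ge:
  assumes f: "f \<in> runner_rules" and v: "v Terminal = 0"
    and le: "\<And>x. x \<in> states \<Longrightarrow> v x \<le> one_step p v x (f x)"
    and s: "s \<in> states"
  shows "v s \<le> rule_val p f s"
proof -
  have \<pi>P: "(\<lambda>t. greedy p (rule_val p f)) \<in> pitcher_markov" (is "?\<pi>P \<in> _")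
    using greedy_stationary stationary_in_markov(2) by blast
  interpret lyapunov_play p \<beta> h "\<lambda>t. f" ?\<pi>P s
    by (intro lyapunov_playI stationary_in_markov f \<pi>P s)
  have "v s \<le> val p (\<lambda>t. f) ?\<pi>P s"
    by (rule le_val[of v, OF v], rule order_trans[OF le one_step_le[OF greedy(1)]])
  then show ?thesis
    by (simp add: rule_val_attained[OF f s])
qed

text \<open>A saddle point: \<open>f\<close> secures \<open>v\<close> against every Markov pitcher,
  while the greedy pitcher holds every Markov runner to \<open>v\<close>.\<close>

lemma bellman_solution_opt_val:
  assumes f: "f \<in> runner_rules" and v: "v Terminal = 0" "\<And>s. s \<in> states \<Longrightarrow> one_step p v s (f s) = v s"
    and opt: "\<And>s a. s \<in> states \<Longrightarrow> a \<in> runner_acts s \<Longrightarrow> one_step p v s a \<le> v s"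
    and s: "s \<in> states"
  shows "opt_val p s = v s"
    and "\<pi>R \<in> runner_markov \<Longrightarrow> val p \<pi>R (\<lambda>t. greedy p v) s \<le> v s"
proof -
  let ?I = "\<lambda>\<pi>R. INF \<pi>P\<in>pitcher_markov. val p \<pi>R \<pi>P s"
  have g: "(\<lambda>t. greedy p v) \<in> pitcher_markov"
    using greedy_stationary stationary_in_markov(2) by blast
  show upper: "val p \<pi>R (\<lambda>t. greedy p v) s \<le> v s" if \<pi>R: "\<pi>R \<in> runner_markov" for \<pi>R
  proof -
    interpret lyapunov_play p \<beta> h \<pi>R "\<lambda>t. greedy p v" s
      by (intro lyapunov_playI \<pi>R g s)
    show ?thesis
      by (rule val_le[of v, OF v(1)]) (simp add: greedy(2) opt runner_markovD[OF \<pi>R])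
  qed
  have I_le: "?I \<pi>R \<le> v s" if \<pi>R: "\<pi>R \<in> runner_markov" for \<pi>R
    using cINF_lower[OF val_bdd_below[OF s \<pi>R] g] upper[OF \<pi>R] by (rule order_trans)
  have "v s \<le> ?I (\<lambda>t. f)"
    by (rule cINF_greatest) (use g rule_fixed_point_value(2)[OF f v s] in auto)
  with I_le[OF stationary_in_markov(1)[OF f]] have "?I (\<lambda>t. f) = v s"
    by (rule antisym)
  then show "opt_val p s = v s"
    unfolding opt_val_def
    by (intro cSup_eq_maximum) (use stationary_in_markov(1)[OF f] I_le in force)+
qed

end

section \<open>Monotone geometric convergence of policy iteration\<close>

lemma policy_iteration:
  assumes "continuous_game p" "lyapunov_game p \<beta> h"
    and init: "\<pi> 0 \<in> runner_rules"
    and improve: "\<And>k s. s \<in> states \<Longrightarrow>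
      is_arg_max (one_step p (rule_val p (\<pi> k)) s) (\<lambda>a. a \<in> runner_acts s) (\<pi> (Suc k) s)"
    and s: "s \<in> states"
  shows "incseq (\<lambda>k. rule_val p (\<pi> k) s)" "(\<lambda>k. rule_val p (\<pi> k) s) \<longlonglongrightarrow> opt_val p s"
proof -
  interpret continuous_game p by fact
  interpret lyapunov_game p \<beta> h by fact
  let ?V = "\<lambda>k. rule_val p (\<pi> k)"
  have \<pi>: "\<pi> k \<in> runner_rules" for k
    using init improve by (cases k) (auto simp: runner_rules_def is_arg_max_def)
  have \<pi>_acts: "\<pi> k x \<in> runner_acts x" if "x \<in> states" for k x
    using \<pi>[of k] that by (auto simp: runner_rules_def)
  have improved: "one_step p (?V k) x a \<le> one_step p (?V k) x (\<pi> (Suc k) x)"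
    if "x \<in> states" "a \<in> runner_acts x" for k x a
    using improve[OF that(1), of k] that(2) by (auto simp: is_arg_max_linorder)
  \<comment> \<open>The old action is among the candidates and reproduces \<open>?V k\<close>
    exactly, so the maximizing action does at least as well.\<close>
  have mono: "?V k x \<le> ?V (Suc k) x" if "x \<in> states" for k x
  proof (rule rule_val_ge[of _ "?V k", OF \<pi> rule_val_Terminal[OF \<pi>] _ that])
    show "?V k y \<le> one_step p (?V k) y (\<pi> (Suc k) y)" if "y \<in> states" for y
      using improved[OF that \<pi>_acts[OF that]] rule_val_fixed_point[OF \<pi> that] by metis
  qed
  then show "incseq (\<lambda>k. ?V k s)"
    using s by (intro incseq_SucI)
  \<comment> \<open>A selector of maximizers for each \<open>v\<close>; evaluating
    \<open>one_step\<close> at it gives the Bellman optimality operator.\<close>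
  define A where "A v x = (SOME a. a \<in> runner_acts x \<and>
    (\<forall>b\<in>runner_acts x. one_step p v x b \<le> one_step p v x a))" for v x
  have "A v x \<in> runner_acts x \<and> (\<forall>b\<in>runner_acts x. one_step p v x b \<le> one_step p v x (A v x))"
    if "x \<in> states" for v x
    unfolding A_def by (rule someI_ex) (use one_step_argmax[OF that, of v] in blast)
  then have A: "\<And>v x. x \<in> states \<Longrightarrow> A v x \<in> runner_acts x"
    "\<And>v x a. x \<in> states \<Longrightarrow> a \<in> runner_acts x \<Longrightarrow> one_step p v x a \<le> one_step p v x (A v x)"
    by blast+
  obtain v where v: "v Terminal = 0" "\<And>x. x \<in> states \<Longrightarrow> one_step p v x (A v x) = v x"
  proof (rule weighted_contraction_fixed_point[of "\<lambda>v x. one_step p v x (A v x)"])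
    show "one_step p v Terminal (A v Terminal) = v Terminal" for v
      by (intro one_step_Terminal A) simp
    \<comment> \<open>Compare at the maximizer for \<open>u\<close>, which the maximum for
      \<open>w\<close> dominates.\<close>
    show "one_step p u x (A u x) \<le> one_step p w x (A w x) + \<beta> * C * h x"
      if "0 \<le> C" "\<And>x. x \<in> states \<Longrightarrow> u x \<le> w x + C * h x" "x \<in> states" for u w C x
      using one_step_le_one_step[OF that A(1)[OF that(3), of u]]
        A(2)[OF that(3) A(1)[OF that(3), of u], of w] by linarith
  qed (use that in blast)
  have rules: "A v \<in> runner_rules"
    using A(1) by (auto simp: runner_rules_def)
  have opt: "one_step p v x a \<le> v x" if "x \<in> states" "a \<in> runner_acts x" for x a
    using A(2)[OF that] v(2)[OF that(1)] by metis
  have opt_val: "opt_val p s = v s"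
    by (rule bellman_solution_opt_val(1)[of "A v" v, OF rules v opt s])
  have V_le: "?V k x \<le> v x" if x: "x \<in> states" for k x
  proof -
    have "?V k x \<le> val p (\<lambda>t. \<pi> k) (\<lambda>t. greedy p v) x"
      using greedy_stationary stationary_in_markov(2) by (intro rule_val_le_val \<pi> x) blast
    also have "\<dots> \<le> v x"
      by (rule bellman_solution_opt_val(2)[of "A v" v, OF rules v opt x stationary_in_markov(1)[OF \<pi>]])
    finally show ?thesis .
  qed
  obtain C where C: "0 \<le> C" "\<And>x. x \<in> states \<Longrightarrow> \<bar>v x - ?V 0 x\<bar> \<le> C * h x"
    using bounded_by_h[of "\<lambda>x. v x - ?V 0 x"] v(1) rule_val_Terminal[OF \<pi>] by auto
  \<comment> \<open>One improvement gains at least as much as one application of the optimality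
    operator to \<open>?V k\<close>, so the initial error \<open>C\<close> shrinks by
    \<open>\<beta>\<close> each time.\<close>
  have error: "v x \<le> ?V k x + \<beta> ^ k * C * h x" if "x \<in> states" for k x
    using that
  proof (induction k arbitrary: x)
    case 0
    then show ?case
      using C(2)[of x] by (simp add: abs_le_iff)
  next
    case (Suc k)
    have "v x = one_step p v x (A v x)"
      by (rule v(2)[OF Suc.prems, symmetric])
    also have "\<dots> \<le> one_step p (?V k) x (A v x) + \<beta> * (\<beta> ^ k * C) * h x"
      using C(1) \<beta>(1) Suc.IH by (intro one_step_le_one_step A(1) Suc.prems) simp_all
    also have "one_step p (?V k) x (A v x) \<le> one_step p (?V k) x (\<pi> (Suc k) x)"
      by (intro improved Suc.prems A)
    \<comment> \<open>Monotonicity, as the instance \<open>C = 0\<close> of the contraction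
      estimate.\<close>
    also have "\<dots> \<le> one_step p (?V (Suc k)) x (\<pi> (Suc k) x)"
      using one_step_le_one_step[of 0, OF _ _ Suc.prems \<pi>_acts[OF Suc.prems]] mono by simp
    also have "\<dots> = ?V (Suc k) x"
      by (intro rule_val_fixed_point \<pi> Suc.prems)
    finally show ?case
      by (simp add: mult_ac)
  qed
  have "(\<lambda>k. v s - \<beta> ^ k * (C * h s)) \<longlonglongrightarrow> v s - 0"
    using \<beta> by (intro tendsto_diff tendsto_const tendsto_mult_left_zero LIMSEQ_power_zero) auto
  then have lower: "(\<lambda>k. v s - \<beta> ^ k * (C * h s)) \<longlonglongrightarrow> v s"
    by simp
  have "v s - \<beta> ^ k * (C * h s) \<le> ?V k s" for k
    using error[OF s, of k] by (simp add: mult.assoc)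
  then have "(\<lambda>k. ?V k s) \<longlonglongrightarrow> v s"
    by (intro real_tendsto_sandwich[OF _ _ lower tendsto_const] always_eventually allI V_le s)
  then show "(\<lambda>k. ?V k s) \<longlonglongrightarrow> opt_val p s"
    by (simp add: opt_val)
qed

theorem proposition3:
  fixes p :: "state \<Rightarrow> real \<Rightarrow> real \<Rightarrow> state pmf"
    and \<pi> :: "nat \<Rightarrow> state \<Rightarrow> real"
  assumes law: "transition_law p"
    and absorption: "\<exists>m::nat. (SUP (\<pi>R, \<pi>P, s) \<in> runner_markov \<times> pitcher_markov \<times> states.
           \<P>(\<omega> in path_measure p \<pi>R \<pi>P s. \<omega> m \<noteq> Terminal)) < 1"
    and continuity: "\<And>s (a :: nat \<Rightarrow> real) (a' :: nat \<Rightarrow> real) l l' s'.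
           \<lbrakk>s \<in> states; \<And>k. a k \<in> runner_acts s; \<And>k. a' k \<in> pitcher_acts s (a k);
            a \<longlonglongrightarrow> l; l \<in> runner_acts s; a' \<longlonglongrightarrow> l'; l' \<in> pitcher_acts s l; s' \<in> states\<rbrakk>
           \<Longrightarrow> (\<lambda>k. pmf (p s (a k) (a' k)) s') \<longlonglongrightarrow> pmf (p s l l') s'"
    and init: "\<pi> 0 \<in> runner_rules"
    and improve: "\<And>k s. s \<in> states \<Longrightarrow>
           is_arg_max (one_step p (rule_val p (\<pi> k)) s) (\<lambda>a. a \<in> runner_acts s) (\<pi> (Suc k) s)"
  shows "(\<forall>f\<in>runner_rules. \<forall>s\<in>states.
            (\<exists>\<pi>P. is_arg_min (\<lambda>\<pi>P. val p (\<lambda>t. f) \<pi>P s) (\<lambda>\<pi>P. \<pi>P \<in> pitcher_stationary) \<pi>P) \<and>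
            (\<exists>a. is_arg_max (one_step p (rule_val p f) s) (\<lambda>a. a \<in> runner_acts s) a)) \<and>
         (\<forall>s\<in>states. incseq (\<lambda>k. rule_val p (\<pi> k) s) \<and>
            (\<lambda>k. rule_val p (\<pi> k) s) \<longlonglongrightarrow> opt_val p s)"
proof -
  interpret continuous_game p
    by (unfold_locales, rule law) (rule continuity)
  obtain \<beta> h where lyap: "lyapunov_game p \<beta> h"
    using absorption lyapunov_exists by blast
  then interpret lyapunov_game p \<beta> h .
  show ?thesis
  proof (intro conjI ballI)
    fix f s assume f: "f \<in> runner_rules" and s: "s \<in> states"
    \<comment> \<open>The minimum defining the value of a rule is attained by the greedy response to
      that value itself.\<close>
    show "\<exists>\<pi>P. is_arg_min (\<lambda>\<pi>P. val p (\<lambda>t. f) \<pi>P s) (\<lambda>\<pi>P. \<pi>P \<in> pitcher_stationary) \<pi>P"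
      using greedy_stationary[of "rule_val p f"] rule_val_attained[OF f s]
        rule_val_le_val[OF f s] stationary_in_markov(2)
      by (auto simp: is_arg_min_linorder intro!: exI[of _ "\<lambda>t. greedy p (rule_val p f)"])
    show "\<exists>a. is_arg_max (one_step p (rule_val p f) s) (\<lambda>a. a \<in> runner_acts s) a"
      using one_step_argmax[OF s, of "rule_val p f"] by (auto simp: is_arg_max_linorder)
  next
    fix s assume "s \<in> states"
    then show "incseq (\<lambda>k. rule_val p (\<pi> k) s)"
      "(\<lambda>k. rule_val p (\<pi> k) s) \<longlonglongrightarrow> opt_val p s"
      using policy_iteration[OF continuous_game_axioms lyap init improve] by auto
  qed
qed

end
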